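(* Let $\mathbb{K}\in\{\mathbb{R},\mathbb{C}\}$, $\mathcal{A}=(A_1,\ldots,A_d)$ positive semidefinite matrices in $\mathbb{K}^{n\times n}$ (symmetric/Hermitian), and let $X^*$ be an optimal solution of the program defining $\mathrm{OptSDP}(\mathcal{A})$ with $\operatorname{rank}(X^* )=r$. Sample $x\sim\mathcal{N}_{\mathbb{K}}(0,X^* )$ and set $y=x/\|x\|$. Then $$\mathbb{E}_y\Big[\prod_{i=1}^d\langle y,A_iy\rangle^{1/d}\Big]\ge e^{-L_r(\mathbb{K})}\,\mathrm{OptSDP}(\mathcal{A}).$$
   Context: $\langle x,y\rangle=x^\dagger y$ with $\dagger$ the (conjugate) transpose, $\|x\|^2=\langle x,x\rangle$, $\langle A,X\rangle=\operatorname{Tr}(A^\dagger X)$. $\mathrm{OptSDP}(\mathcal{A})=\max\big\{\big(\prod_{i=1}^d\langle A_i,X\rangle\big)^{1/d}: X\text{ symmetric/Hermitian},\ X\succeq0,\ \operatorname{Tr}X=1\big\}$. $\mathcal{N}_{\mathbb{K}}(0,I_m)$: if $\mathbb{K}=\mathbb{R}$ the coordinates are i.i.d. standard normal; if $\mathbb{K}=\mathbb{C}$, the coordinates are $(a_j+\mathrm{i}b_j)/\sqrt2$ with $a_j,b_j$ i.i.d. standard normal. For $\Sigma=UU^\dagger\succeq0$, $\mathcal{N}_{\mathbb{K}}(0,\Sigma)$ is the law of $Uw$ with $w\sim\mathcal{N}_{\mathbb{K}}(0,I)$. $L_r(\mathbb{R})=\gamma+\log2+\psi(r/2)-\log(r/2)$,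 $L_r(\mathbb{C})=\gamma+\psi(r)-\log r$ ($\gamma$ Euler–Mascheroni constant, $\psi$ digamma function). *)

theory Defs
  imports "HOL-Analysis.Analysis" "HOL-Probability.Probability"
begin

text \<open>The ground field K, either the reals or the complex numbers. Real vectors and matrices
are represented as complex ones all of whose entries are real.\<close>
datatype field_K = RealK | ComplexK

definition in_K :: "field_K \<Rightarrow> complex \<Rightarrow> bool" where
  "in_K K z \<longleftrightarrow> (K = RealK \<longrightarrow> Im z = 0)"

definition vec_K :: "field_K \<Rightarrow> complex^'n \<Rightarrow> bool" where
  "vec_K K x \<longleftrightarrow> (\<forall>i. in_K K (x $ i))"

definition mat_K :: "field_K \<Rightarrow> complex^'n^'m \<Rightarrow> bool" where
  "mat_K K A \<longleftrightarrow> (\<forall>i j. in_K K (A $ i $ j))"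

definition ctrans :: "complex^'n^'m \<Rightarrow> complex^'m^'n" where
  "ctrans A = (\<chi> i j. cnj (A $ j $ i))"

definition vinner :: "complex^'n \<Rightarrow> complex^'n \<Rightarrow> complex" where
  "vinner x y = (\<Sum>i\<in>UNIV. cnj (x $ i) * y $ i)"

definition minner :: "complex^'n^'n \<Rightarrow> complex^'n^'n \<Rightarrow> complex" where
  "minner A X = trace (ctrans A ** X)"

definition hermitian :: "complex^'n^'n \<Rightarrow> bool" where
  "hermitian A \<longleftrightarrow> ctrans A = A"

definition psd_K :: "field_K \<Rightarrow> complex^'n^'n \<Rightarrow> bool" where
  "psd_K K A \<longleftrightarrow> mat_K K A \<and> hermitian A \<and>
     (\<forall>x. vec_K K x \<longrightarrow> 0 \<le> Re (vinner x (A *v x)))"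

definition sdp_feasible :: "field_K \<Rightarrow> (complex^'n^'n) set" where
  "sdp_feasible K = {X. psd_K K X \<and> trace X = 1}"

text \<open>Objective \<open>(\<Prod>i. \<langle>A_i,X\<rangle>)^(1/d)\<close>, with \<open>A = (A 0, ..., A (d-1))\<close>.
  For feasible X and PSD A_i the values \<open>\<langle>A_i,X\<rangle>\<close> are real and nonnegative.\<close>
definition sdp_obj :: "nat \<Rightarrow> (nat \<Rightarrow> complex^'n^'n) \<Rightarrow> complex^'n^'n \<Rightarrow> real" where
  "sdp_obj d A X = (\<Prod>i<d. Re (minner (A i) X)) powr (1 / real d)"

definition OptSDP :: "field_K \<Rightarrow> nat \<Rightarrow> (nat \<Rightarrow> complex^'n^'n) \<Rightarrow> real" where
  "OptSDP K d A = (SUP X\<in>sdp_feasible K. sdp_obj d A X)"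

definition sdp_optimal :: "field_K \<Rightarrow> nat \<Rightarrow> (nat \<Rightarrow> complex^'n^'n) \<Rightarrow> complex^'n^'n \<Rightarrow> bool" where
  "sdp_optimal K d A X \<longleftrightarrow> X \<in> sdp_feasible K \<and>
     (\<forall>Y\<in>sdp_feasible K. sdp_obj d A Y \<le> sdp_obj d A X)"

definition gauss_noise :: "('n::finite \<times> bool \<Rightarrow> real) measure" where
  "gauss_noise = PiM UNIV (\<lambda>_. density lborel std_normal_density)"

definition std_gauss_vec :: "field_K \<Rightarrow> ('n::finite \<times> bool \<Rightarrow> real) \<Rightarrow> complex^'n" where
  "std_gauss_vec K g = (\<chi> j. (case K of
       RealK \<Rightarrow> complex_of_real (g (j, False))
     | ComplexK \<Rightarrow> Complex (g (j, False)) (g (j, True)) / complex_of_real (sqrt 2)))"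

definition gauss_K :: "field_K \<Rightarrow> complex^'n^'n \<Rightarrow> (complex^'n::finite) measure" where
  "gauss_K K \<Sigma> = distr gauss_noise borel
     (\<lambda>g. (SOME U :: complex^'n^'n. mat_K K U \<and> \<Sigma> = U ** ctrans U) *v std_gauss_vec K g)"

definition L_const :: "field_K \<Rightarrow> nat \<Rightarrow> real" where
  "L_const K r = (case K of
      RealK \<Rightarrow> euler_mascheroni + ln 2 + Digamma (real r / 2) - ln (real r / 2)
    | ComplexK \<Rightarrow> euler_mascheroni + Digamma (real r) - ln (real r))"

end

theory Submission
  imports Defs "HOL-Real_Asymp.Real_Asymp"
begin

text \<open>Factor the optimal solution as \<open>Xs = C C\<^sup>\<dagger>\<close> with exactly \<open>r = rank Xs\<close> nonzero columns,
  indexed by \<open>S\<close>. Since \<open>Xs\<close> determines its square factors up to a unitary on the right, the sampled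
  vector has the law of \<open>C w\<close> with \<open>w\<close> standard Gaussian, and Jensen's inequality reduces the claim to
  bounds on expected logarithms. Writing \<open>A\<^sub>i = B B\<^sup>\<dagger>\<close>, concavity of the logarithm and rotation
  invariance give \<open>E ln \<parallel>B\<^sup>\<dagger> C w\<parallel>\<^sup>2 \<ge> ln \<langle>A\<^sub>i, Xs\<rangle> + E ln |w\<^sub>1|\<^sup>2\<close>. In the other direction, the tangent
  of the logarithm at \<open>q / r\<close> with \<open>q = \<Sum>\<^sub>j\<^sub>\<in>\<^sub>S |w\<^sub>j|\<^sup>2\<close> gives
  \<open>ln \<parallel>C w\<parallel>\<^sup>2 \<le> ln (q / r) + r \<parallel>C w\<parallel>\<^sup>2 / q - 1\<close>, and \<open>E (\<parallel>C w\<parallel>\<^sup>2 / q) = 1 / r\<close> by symmetry. Finally \<open>q\<close> is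
  Gamma distributed, so \<open>E ln q\<close> is a digamma value.\<close>

section \<open>Unitary matrices over K\<close>

text \<open>Applying Jensen directly to \<open>\<parallel>C w\<parallel>^2\<close>, whose mean is 1,
  would give only \<open>E ln \<parallel>C w\<parallel>^2 \<le> 0\<close> and lose all dependence on
  the rank. Placing the tangent at the random point \<open>q / r\<close> replaces this 0 by
  \<open>E ln q - ln r\<close>, which is at most 0; the bound is exact when the nonzero eigenvalues
  of \<open>Xs\<close> coincide, since then \<open>\<parallel>C w\<parallel>^2 = q / r\<close>. The
  exponent \<open>L_const K r\<close> is this number minus \<open>E ln |w_1|^2\<close>.
  Integrability of the logarithms of the quadratic forms is never established: the bounds are
  explicit functions with known means that lie below or above these logarithms almost everywhere.
  Unitary matrices serve twice, to absorb the unspecified factor in \<open>gauss_K\<close> and to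
  reduce a linear form in \<open>w\<close> to one coordinate. Both uses rest on a single
  Householder-type map, which therefore has to exist over both fields.\<close>

lemma vinner_add_right: "vinner x (y + z) = vinner x y + vinner x z"
  by (simp add: vinner_def algebra_simps sum.distrib)

lemma vinner_add_left: "vinner (x + y) z = vinner x z + vinner y z"
  by (simp add: vinner_def algebra_simps sum.distrib)

lemma vinner_diff_right: "vinner x (y - z) = vinner x y - vinner x z"
  by (simp add: vinner_def algebra_simps sum_subtractf)

lemma vinner_diff_left: "vinner (x - y) z = vinner x z - vinner y z"
  by (simp add: vinner_def algebra_simps sum_subtractf)

lemma vinner_scale_right: "vinner x (c *s y) = c * vinner x y"
  by (simp add: vinner_def sum_distrib_left mult_ac)

lemma vinner_scale_left: "vinner (c *s x) y = cnj c * vinner x y"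
  by (simp add: vinner_def sum_distrib_left mult_ac)

lemma vinner_zero_left [simp]: "vinner 0 y = 0"
  by (simp add: vinner_def)

lemmas vinner_simps = vinner_add_right vinner_add_left vinner_diff_right vinner_diff_left
  vinner_scale_right vinner_scale_left

lemma cnj_vinner: "cnj (vinner x y) = vinner y x"
  by (simp add: vinner_def mult.commute)

lemma vinner_self: "vinner x x = of_real ((norm x)\<^sup>2)"
proof -
  have "vinner x x = (\<Sum>i\<in>UNIV. of_real ((cmod (x $ i))\<^sup>2))"
    by (simp add: vinner_def complex_norm_square mult.commute del: of_real_power)
  also have "\<dots> = of_real ((norm x)\<^sup>2)"
    by (simp add: norm_vec_def L2_set_def sum_nonneg)
  finally show ?thesis .
qed

lemma vinner_axis_left: "vinner (axis i 1) x = x $ i"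
  by (simp add: vinner_def axis_def if_distrib[of cnj] mult_delta_left mult_delta_right cong: if_cong)

lemma ctrans_nth [simp]: "ctrans A $ i $ j = cnj (A $ j $ i)"
  by (simp add: ctrans_def)

lemma ctrans_ctrans [simp]: "ctrans (ctrans A) = A"
  by (simp add: vec_eq_iff)

lemma ctrans_mult: "ctrans (A ** B) = ctrans B ** ctrans A"
  by (simp add: vec_eq_iff matrix_matrix_mult_def mult.commute)

lemma vinner_mult_right: "vinner x (A *v y) = vinner (ctrans A *v x) y"
  unfolding vinner_def matrix_vector_mult_def
  by (simp add: sum_distrib_left sum_distrib_right, subst sum.swap, simp add: mult_ac)

lemma vinner_mult_left: "vinner (A *v x) y = vinner x (ctrans A *v y)"
  by (simp add: vinner_mult_right)

section \<open>Closure of scalars, vectors and matrices over K under the algebraic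
  operations\<close>

lemma in_K_simps [simp]:
  "in_K K 0" "in_K K 1" "in_K K (of_real r)"
  "in_K K a \<Longrightarrow> in_K K b \<Longrightarrow> in_K K (a + b)"
  "in_K K a \<Longrightarrow> in_K K b \<Longrightarrow> in_K K (a - b)"
  "in_K K a \<Longrightarrow> in_K K b \<Longrightarrow> in_K K (a * b)"
  "in_K K a \<Longrightarrow> in_K K b \<Longrightarrow> in_K K (a / b)"
  "in_K K a \<Longrightarrow> in_K K (cnj a)"
  "in_K K a \<Longrightarrow> in_K K (- a)"
  by (auto simp: in_K_def Im_divide)

lemma in_K_sum: "(\<And>i. i \<in> I \<Longrightarrow> in_K K (f i)) \<Longrightarrow> in_K K (sum f I)"
  by (auto simp: in_K_def)

lemma vec_K_axis: "vec_K K (axis i 1)"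
  by (simp add: vec_K_def axis_def)

lemma vec_K_diff: "vec_K K x \<Longrightarrow> vec_K K y \<Longrightarrow> vec_K K (x - y)"
  by (simp add: vec_K_def)

lemma vec_K_scale: "in_K K c \<Longrightarrow> vec_K K x \<Longrightarrow> vec_K K (c *s x)"
  by (simp add: vec_K_def)

lemma in_K_vinner: "vec_K K x \<Longrightarrow> vec_K K y \<Longrightarrow> in_K K (vinner x y)"
  by (auto simp: vinner_def vec_K_def intro!: in_K_sum)

lemma vec_K_mult: "mat_K K A \<Longrightarrow> vec_K K x \<Longrightarrow> vec_K K (A *v x)"
  by (auto simp: matrix_vector_mult_def vec_K_def mat_K_def intro!: in_K_sum)

lemma mat_K_mult: "mat_K K A \<Longrightarrow> mat_K K B \<Longrightarrow> mat_K K (A ** B)"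
  by (auto simp: matrix_matrix_mult_def mat_K_def intro!: in_K_sum)

lemma mat_K_ctrans: "mat_K K A \<Longrightarrow> mat_K K (ctrans A)"
  by (simp add: mat_K_def)

lemma mat_K_mat_1: "mat_K K (mat 1)"
  by (simp add: mat_K_def mat_def)

definition unitary_K :: "field_K \<Rightarrow> complex^'n^'n \<Rightarrow> bool" where
  "unitary_K K V \<longleftrightarrow> mat_K K V \<and> ctrans V ** V = mat 1"

lemma unitary_K_mat_1: "unitary_K K (mat 1 :: complex^'n^'n)"
proof -
  have "ctrans (mat 1 :: complex^'n^'n) = mat 1"
    by (auto simp: vec_eq_iff mat_def)
  then show ?thesis by (simp add: unitary_K_def mat_K_mat_1)
qed

lemma unitary_K_right_inverse: "unitary_K K V \<Longrightarrow> V ** ctrans V = mat 1"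
  by (metis matrix_left_right_inverse unitary_K_def)

lemma unitary_K_mult: "unitary_K K V \<Longrightarrow> unitary_K K W \<Longrightarrow> unitary_K K (V ** W)"
  unfolding unitary_K_def
  by (simp add: mat_K_mult ctrans_mult)
     (metis matrix_mul_assoc matrix_mul_lid)

lemma unitary_K_vinner:
  assumes "unitary_K K V" shows "vinner (V *v x) (V *v y) = vinner x y"
  using assms by (simp add: vinner_mult_left matrix_vector_mul_assoc unitary_K_def)

lemma unitary_K_norm:
  assumes "unitary_K K V" shows "norm (V *v x) = norm x"
proof -
  have "complex_of_real ((norm (V *v x))\<^sup>2) = of_real ((norm x)\<^sup>2)"
    using unitary_K_vinner[OF assms, of x x] by (simp only: vinner_self)
  then show ?thesis by (simp del: of_real_power)
qed

lemma unitary_KI: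
  assumes "mat_K K V" and "\<And>x y. vinner (V *v x) (V *v y) = vinner x y"
  shows "unitary_K K V"
proof -
  have "(ctrans V ** V) $ i $ j = mat 1 $ i $ j" for i j
  proof -
    have "(ctrans V ** V) $ i $ j = vinner (axis i 1) ((ctrans V ** V) *v axis j 1)"
      unfolding vinner_axis_left by (simp add: matrix_vector_mult_def axis_def mult_delta_right cong: if_cong)
    also have "\<dots> = vinner (V *v axis i 1) (V *v axis j 1)"
      by (simp add: vinner_mult_left matrix_vector_mul_assoc)
    also have "\<dots> = mat 1 $ i $ j"
      unfolding assms(2) vinner_axis_left by (auto simp: axis_def mat_def)
    finally show ?thesis .
  qed
  then show ?thesis using assms(1) by (simp add: unitary_K_def vec_eq_iff)
qed

text \<open>The matrix is \<open>I - v v\<^sup>\<dagger> / \<langle>v, a\<rangle>\<close> with \<open>v = a - b\<close>. Over the complex numbers this is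
  not a reflection, but unitary nevertheless because \<open>2 Re \<langle>v, a\<rangle> = \<parallel>v\<parallel>\<^sup>2\<close>.\<close>
lemma householder_exists:
  fixes a b :: "complex^'n"
  assumes K: "vec_K K a" "vec_K K b" and eq: "vinner a a = vinner b b"
  obtains V where "unitary_K K V" "V *v a = b"
    "\<And>x. \<exists>c. V *v x = x - (c * vinner (a - b) x) *s (a - b)"
proof (cases "a = b")
  case True
  show ?thesis by (rule that[of "mat 1"]) (auto simp: True unitary_K_mat_1)
next
  case False
  define v where "v = a - b"
  define w where "w = vinner v a"
  define V :: "complex^'n^'n" where
    "V = (\<chi> i j. (if i = j then 1 else 0) - v $ i * cnj (v $ j) / w)"
  have vK: "vec_K K v" using K by (simp add: v_def vec_K_diff)
  have N: "vinner v v = w + cnj w"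
    by (simp add: w_def v_def cnj_vinner vinner_simps eq)
  have "vinner v v \<noteq> 0" using False by (simp add: v_def vinner_self)
  then have w0: "w \<noteq> 0" using N by auto
  have Vx: "V *v x = x - (1 / w * vinner v x) *s v" for x
    by (simp add: vec_eq_iff V_def matrix_vector_mult_def vinner_def algebra_simps sum_subtractf
        sum_distrib_left sum_distrib_right sum_divide_distrib mult_delta_left mult_delta_right cong: if_cong)
  have mK: "mat_K K V"
    using vK by (auto simp: mat_K_def V_def w_def vec_K_def intro!: in_K_simps in_K_vinner K(1))
  have "vinner (V *v x) (V *v y) = vinner x y" for x y
  proof -
    have "vinner (V *v x) (V *v y) = vinner x y
        + vinner x v * vinner v y * (vinner v v - cnj w - w) / (w * cnj w)"
      using w0 by (simp add: Vx vinner_simps cnj_vinner) (simp add: field_simps)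
    then show ?thesis by (simp add: N)
  qed
  then have U: "unitary_K K V" by (intro unitary_KI mK)
  have "V *v a = b" using w0 by (simp add: Vx w_def[symmetric]) (simp add: v_def)
  with U show ?thesis using that Vx unfolding v_def by blast
qed

text \<open>Induction on the index set. If \<open>V\<close> already handles \<open>I\<close>, it is
  composed with the Householder map \<open>W\<close> taking \<open>V *v a k\<close> to
  \<open>b k\<close>. Equal Gram matrices make each earlier \<open>b i\<close> orthogonal to
  \<open>V *v a k - b k\<close>, and \<open>W\<close> displaces a vector along that direction in
  proportion to this inner product, so \<open>W\<close> fixes every \<open>b i\<close>.\<close>

lemma unitary_exists_of_gram_eq:
  fixes a b :: "'i \<Rightarrow> complex^'n"
  assumes "finite I" "\<And>i. i \<in> I \<Longrightarrow> vec_K K (a i)" "\<And>i. i \<in> I \<Longrightarrow> vec_K K (b i)"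
    "\<And>i j. i \<in> I \<Longrightarrow> j \<in> I \<Longrightarrow> vinner (a i) (a j) = vinner (b i) (b j)"
  shows "\<exists>V. unitary_K K V \<and> (\<forall>i\<in>I. V *v a i = b i)"
  using assms
proof (induction I)
  case empty
  then show ?case using unitary_K_mat_1 by blast
next
  case (insert k I)
  then obtain V where V: "unitary_K K V" "\<forall>i\<in>I. V *v a i = b i" by auto
  have VK: "mat_K K V" using V by (simp add: unitary_K_def)
  obtain W where W: "unitary_K K W" "W *v (V *v a k) = b k"
    and Wx: "\<And>x. \<exists>c. W *v x = x - (c * vinner (V *v a k - b k) x) *s (V *v a k - b k)"
    by (rule householder_exists[of K "V *v a k" "b k"])
       (use insert.prems VK V(1) in \<open>auto simp: vec_K_mult unitary_K_vinner\<close>)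
  have "W *v b i = b i" if "i \<in> I" for i
  proof -
    have "vinner (V *v a k) (b i) = vinner (V *v a k) (V *v a i)"
      using V(2) that by simp
    also have "\<dots> = vinner (b k) (b i)"
      using insert.prems that by (simp add: unitary_K_vinner[OF V(1)])
    finally show ?thesis using Wx[of "b i"] by (auto simp: vinner_diff_left)
  qed
  then show ?case using V W
    by (intro exI[of _ "W ** V"]) (auto simp: unitary_K_mult matrix_vector_mul_assoc[symmetric])
qed

text \<open>The entries of \<open>U ** ctrans U\<close> are the inner products of the columns of
  \<open>ctrans U\<close>, and likewise for \<open>C\<close>. Equal products thus mean equal Gram
  matrices; the unitary carrying one family of columns to the other gives \<open>V\<close> after
  taking adjoints. This covers singular factors, for which \<open>V\<close> is not unique.\<close>

lemma factor_unique_up_to_unitary: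
  fixes U C :: "complex^'n^'n"
  assumes "mat_K K U" "mat_K K C" "U ** ctrans U = C ** ctrans C"
  obtains V where "unitary_K K V" "U = C ** V"
proof -
  define col where "col M i = ctrans M *v axis i 1" for M :: "complex^'n^'n" and i
  have gram: "vinner (col M i) (col M j) = (M ** ctrans M) $ i $ j" for M :: "complex^'n^'n" and i j
    by (simp add: col_def vinner_mult_left matrix_vector_mul_assoc vinner_axis_left)
       (simp add: matrix_vector_mult_def axis_def mult_delta_right cong: if_cong)
  have "\<exists>V. unitary_K K V \<and> (\<forall>i\<in>UNIV. V *v col U i = col C i)"
    using assms by (intro unitary_exists_of_gram_eq)
      (auto simp: gram assms(3), auto simp: col_def intro!: vec_K_mult mat_K_ctrans vec_K_axis)
  then obtain V where V: "unitary_K K V" "\<And>i. V *v col U i = col C i" by auto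
  have "(V ** ctrans U) $ j $ i = ctrans C $ j $ i" for i j
  proof -
    have "(V ** ctrans U) *v axis i 1 = ctrans C *v axis i 1"
      using V(2)[of i] by (simp add: col_def matrix_vector_mul_assoc)
    then show ?thesis
      by (simp add: vec_eq_iff) (simp add: matrix_vector_mult_def axis_def mult_delta_right cong: if_cong)
  qed
  then have "V ** ctrans U = ctrans C" by (simp add: vec_eq_iff)
  then have "C = U ** ctrans V" by (metis ctrans_ctrans ctrans_mult)
  then have "U = C ** V"
    using V(1) by (simp add: matrix_mul_assoc[symmetric] unitary_K_def)
  then show ?thesis using V that by blast
qed

section \<open>Cholesky factorisation\<close>

lemma vinner_axis_mult_axis: "vinner (axis i 1) (X *v axis j 1) = X $ i $ j"
  unfolding vinner_axis_left by (simp add: matrix_vector_mult_def axis_def mult_delta_right cong: if_cong)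

lemma hermitian_nth: "hermitian X \<Longrightarrow> cnj (X $ i $ j) = X $ j $ i"
  by (metis ctrans_nth hermitian_def)

lemma psd_K_diag:
  assumes "psd_K K X" shows "0 \<le> Re (X $ i $ i)" "Im (X $ i $ i) = 0"
proof -
  show "0 \<le> Re (X $ i $ i)"
    using assms vec_K_axis[of K i] vinner_axis_mult_axis[of i X i] unfolding psd_K_def by metis
  show "Im (X $ i $ i) = 0"
    using hermitian_nth[of X i i] assms by (simp add: psd_K_def complex_eq_iff)
qed

text \<open>If the diagonal entry vanishes, the quadratic form at \<open>e_j - c e_i\<close> is
  affine in the real and imaginary parts of \<open>c\<close>, so a nonzero \<open>X $ i $ j\<close>
  would make it negative for a suitable \<open>c\<close>.\<close>

lemma psd_K_row_zero:
  assumes X: "psd_K K X" and "X $ i $ i = 0"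
  shows "X $ i $ j = 0"
proof (rule ccontr)
  assume nz: "X $ i $ j \<noteq> 0"
  define q where "q = (cmod (X $ i $ j))\<^sup>2"
  \<comment> \<open>This \<open>t\<close> makes the form equal to -1; taking \<open>c\<close> as a
    real multiple of \<open>X $ i $ j\<close> keeps the test vector over K.\<close>
  define t where "t = (Re (X $ j $ j) + 1) / (2 * q)"
  define c where "c = of_real t * X $ i $ j"
  have q: "q > 0" using nz by (simp add: q_def)
  have h: "cnj (X $ i $ j) = X $ j $ i" using X by (simp add: psd_K_def hermitian_nth)
  have qq: "X $ i $ j * X $ j $ i = of_real q"
    by (simp add: q_def complex_norm_square h[symmetric] del: of_real_power)
  have "vec_K K (axis j 1 - c *s axis i 1)"
    using X by (intro vec_K_diff vec_K_scale vec_K_axis) (simp add: c_def psd_K_def mat_K_def)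
  then have "0 \<le> Re (vinner (axis j 1 - c *s axis i 1) (X *v (axis j 1 - c *s axis i 1)))"
    using X by (simp add: psd_K_def)
  also have "vinner (axis j 1 - c *s axis i 1) (X *v (axis j 1 - c *s axis i 1))
      = X $ j $ j - (2 * of_real t) * (X $ i $ j * X $ j $ i)"
    by (simp add: matrix_vector_mult_diff_distrib vector_scalar_commute vinner_simps
        vinner_axis_mult_axis assms(2) c_def h algebra_simps)
  also have "Re \<dots> = Re (X $ j $ j) - 2 * t * q" by (simp add: qq)
  also have "\<dots> = -1" using q by (simp add: t_def field_simps)
  finally show False by simp
qed

text \<open>The Schur complement of a pivot, i.e. one step of the Cholesky decomposition.\<close>
lemma psd_K_schur:
  fixes X :: "complex^'n^'n"
  assumes X: "psd_K K X" and nz: "X $ i $ i \<noteq> 0"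
  shows "psd_K K (\<chi> j l. X $ j $ l - X $ j $ i * X $ i $ l / X $ i $ i)" (is "psd_K K ?Y")
proof -
  have XK: "mat_K K X" and XH: "hermitian X"
    and pos: "\<And>x. vec_K K x \<Longrightarrow> 0 \<le> Re (vinner x (X *v x))"
    using X by (auto simp: psd_K_def)
  have "mat_K K ?Y" using XK by (auto simp: mat_K_def)
  moreover have "hermitian ?Y"
    by (simp add: hermitian_def vec_eq_iff hermitian_nth[OF XH])
  moreover have "0 \<le> Re (vinner y (?Y *v y))" if y: "vec_K K y" for y
  proof -
    \<comment> \<open>Completing the square: with this \<open>c\<close> the vector
      \<open>X *v z\<close> vanishes at \<open>i\<close>, and the form of \<open>X\<close> at
      \<open>z\<close> equals the form of the Schur complement at \<open>y\<close>.\<close>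
    define c where "c = (X *v y) $ i / X $ i $ i"
    define z where "z = y - c *s axis i 1"
    have "in_K K c"
      using vec_K_mult[OF XK y] XK by (simp add: c_def vec_K_def mat_K_def)
    then have "vec_K K z" using y by (simp add: z_def vec_K_diff vec_K_scale vec_K_axis)
    then have z: "0 \<le> Re (vinner z (X *v z))" by (rule pos)
    have ip: "vinner (axis i 1) (X *v y) = c * X $ i $ i"
      using nz by (simp add: vinner_axis_left c_def)
    have "vinner z (X *v z) = vinner y (X *v y) - c * vinner y (X *v axis i 1)"
      by (simp add: z_def matrix_vector_mult_diff_distrib vector_scalar_commute vinner_simps
        vinner_axis_mult_axis ip algebra_simps)
    also have "\<dots> = vinner y (X *v y - c *s (X *v axis i 1))"
      by (simp only: vinner_diff_right vinner_scale_right)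
    also have "X *v y - c *s (X *v axis i 1) = ?Y *v y"
      by (simp add: vec_eq_iff c_def matrix_vector_mult_def axis_def algebra_simps sum_subtractf
        sum_distrib_left sum_distrib_right sum_divide_distrib mult_delta_right cong: if_cong)
    finally have "vinner z (X *v z) = vinner y (?Y *v y)" .
    with z show ?thesis by simp
  qed
  ultimately show ?thesis by (simp add: psd_K_def)
qed

text \<open>\<open>T\<close> contains the rows that may still be nonzero; each step either drops a
  zero row or removes a pivot by a Schur complement. Carrying independence and the row span through
  the induction is what makes the number of summands equal to the rank.\<close>

lemma cholesky_on:
  fixes X :: "complex^'n^'n"
  assumes "finite T" "psd_K K X" "\<forall>i j. i \<notin> T \<longrightarrow> X $ i $ j = 0"
  shows "\<exists>S u. S \<subseteq> T \<and> (\<forall>k\<in>S. vec_K K (u k)) \<and>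
    (\<forall>i j. X $ i $ j = (\<Sum>k\<in>S. cnj (u k $ i) * u k $ j)) \<and> inj_on u S \<and>
    vec.independent (u ` S) \<and> vec.span (u ` S) = vec.span (rows X)"
  using assms
proof (induction T arbitrary: X)
  case empty
  then have "X = 0" by (simp add: vec_eq_iff)
  then have "rows X = {0}" by (auto simp: rows_def row_def vec_eq_iff)
  then show ?case using \<open>X = 0\<close>
    by (intro exI[of _ "{}"]) (simp add: vec.independent_empty)
next
  case (insert i T)
  show ?case
  proof (cases "X $ i $ i = 0")
    case True
    then have "X $ i $ j = 0" for j using psd_K_row_zero insert.prems(1) by blast
    with insert.prems(2) have "\<forall>k j. k \<notin> T \<longrightarrow> X $ k $ j = 0"
      by (metis insertE)
    from insert.IH[OF insert.prems(1) this] obtain S u where "S \<subseteq> T" "\<forall>k\<in>S. vec_K K (u k)"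
      "\<forall>i j. X $ i $ j = (\<Sum>k\<in>S. cnj (u k $ i) * u k $ j)" "inj_on u S"
      "vec.independent (u ` S)" "vec.span (u ` S) = vec.span (rows X)"
      by auto
    then show ?thesis by (intro exI[of _ S] exI[of _ u] conjI) auto
  next
    case False
    define s where "s = sqrt (Re (X $ i $ i))"
    \<comment> \<open>Since \<open>s * s = X $ i $ i\<close>, the rank-one matrix built from
      \<open>u0\<close> is exactly what the Schur complement subtracts.\<close>
    define u0 where "u0 = of_real (1 / s) *s row i X"
    define Y where "Y = (\<chi> j l. X $ j $ l - X $ j $ i * X $ i $ l / X $ i $ i)"
    have XH: "hermitian X" and XK: "mat_K K X" using insert.prems(1) by (simp_all add: psd_K_def)
    have Re0: "Re (X $ i $ i) > 0" and Xii: "X $ i $ i = of_real (s * s)"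
      using psd_K_diag[OF insert.prems(1), of i] False by (auto simp: s_def complex_eq_iff)
    have s: "s > 0" using Re0 by (simp add: s_def)
    have Ys: "Y $ j $ l = X $ j $ l - cnj (u0 $ j) * u0 $ l" for j l
      using s by (simp add: Y_def u0_def row_def Xii hermitian_nth[OF XH])
    have Y: "psd_K K Y" unfolding Y_def by (rule psd_K_schur) fact+
    have Y0: "\<forall>k j. k \<notin> T \<longrightarrow> Y $ k $ j = 0"
    proof (intro allI impI)
      fix k j assume "k \<notin> T"
      then show "Y $ k $ j = 0"
        using insert.prems(2) False by (cases "k = i") (auto simp: Y_def)
    qed
    from insert.IH[OF Y Y0] obtain S u where S: "S \<subseteq> T" and uK: "\<forall>k\<in>S. vec_K K (u k)"
      and Yu: "\<forall>i j. Y $ i $ j = (\<Sum>k\<in>S. cnj (u k $ i) * u k $ j)"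
      and inj: "inj_on u S" and ind: "vec.independent (u ` S)"
      and span: "vec.span (u ` S) = vec.span (rows Y)" by auto
    have fS: "finite S" and iS: "i \<notin> S" using S insert.hyps finite_subset by auto
    define u' where "u' = u(i := u0)"
    have im: "u' ` insert i S = insert u0 (u ` S)" using iS by (auto simp: u'_def)
    have Yi: "Y $ j $ i = 0" for j using False by (simp add: Y_def)
    \<comment> \<open>Column \<open>i\<close> of the Schur complement is zero, so its whole row span
      vanishes at coordinate \<open>i\<close>, whereas \<open>u0\<close> does not. This gives
      independence.\<close>
    have "vec.span (rows Y) \<subseteq> {w. w $ i = 0}"
      by (intro vec.span_minimal vec.subspaceI) (auto simp: rows_def row_def Yi)
    moreover have "u0 $ i \<noteq> 0" using False s by (simp add: u0_def row_def)
    ultimately have notin: "u0 \<notin> vec.span (u ` S)" using span by auto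
    have ind': "vec.independent (u' ` insert i S)"
      unfolding im by (rule vec.independent_insertI[OF notin ind])
    have "inj_on u' (insert i S)"
    proof -
      have "u0 \<notin> u ` S" using notin vec.span_base by blast
      then show ?thesis using inj iS by (auto simp: inj_on_def u'_def)
    qed
    moreover have "\<forall>k\<in>insert i S. vec_K K (u' k)"
      using uK XK by (auto simp: u'_def u0_def vec_K_def row_def mat_K_def)
    moreover have "\<forall>j l. X $ j $ l = (\<Sum>k\<in>insert i S. cnj (u' k $ j) * u' k $ l)"
    proof (intro allI)
      fix j l
      have "(\<Sum>k\<in>S. cnj (u' k $ j) * u' k $ l) = (\<Sum>k\<in>S. cnj (u k $ j) * u k $ l)"
        using iS by (intro sum.cong) (auto simp: u'_def)
      then show "X $ j $ l = (\<Sum>k\<in>insert i S. cnj (u' k $ j) * u' k $ l)"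
        using fS iS Yu[rule_format, of j l] Ys[of j l] by (simp add: u'_def[THEN fun_cong, of i, simplified] algebra_simps)
    qed
    moreover have "vec.span (u' ` insert i S) = vec.span (rows X)"
    proof -
      have rowY: "row j Y = row j X - cnj (u0 $ j) *s u0" for j
        by (simp add: vec_eq_iff row_def Ys)
      have rX: "row j X \<in> vec.span (rows X)" for j
        by (rule vec.span_base) (auto simp: rows_def)
      have u0X: "u0 \<in> vec.span (rows X)"
        unfolding u0_def by (intro vec.span_scale vec.span_base) (auto simp: rows_def)
      have "vec.span (insert u0 (u ` S)) = vec.span (insert u0 (rows Y))"
        using span by (simp add: vec.span_insert)
      also have "\<dots> = vec.span (rows X)"
      proof (rule vec.span_eq[THEN iffD2], intro conjI subsetI)
        fix w assume "w \<in> insert u0 (rows Y)"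
        then show "w \<in> vec.span (rows X)"
          by (auto simp: rows_def[of Y] rowY intro!: vec.span_diff vec.span_scale rX u0X)
      next
        fix w assume "w \<in> rows X"
        then obtain j where w: "w = row j X" by (auto simp: rows_def)
        have "w = row j Y + cnj (u0 $ j) *s u0" by (simp add: rowY w)
        also have "\<dots> \<in> vec.span (insert u0 (rows Y))"
          by (intro vec.span_add vec.span_scale vec.span_base) (auto simp: rows_def)
        finally show "w \<in> vec.span (insert u0 (rows Y))" .
      qed
      finally show ?thesis by (simp only: im)
    qed
    ultimately show ?thesis using S ind'
      by (intro exI[of _ "insert i S"] exI[of _ u']) auto
  qed
qed

text \<open>The conjugated vectors \<open>u k\<close> become the columns of \<open>C\<close> at the
  pivots \<open>S\<close>; the other columns are zero padding. The padding keeps \<open>C\<close>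
  square, like the factor chosen in \<open>gauss_K\<close>, while \<open>S\<close> still records the
  rank.\<close>

theorem psd_K_factor:
  fixes X :: "complex^'n^'n"
  assumes "psd_K K X"
  obtains C :: "complex^'n^'n" and S where "mat_K K C" "X = C ** ctrans C" "card S = rank X"
    "\<And>i k. k \<notin> S \<Longrightarrow> C $ i $ k = 0"
proof -
  have zero: "\<forall>i j. i \<notin> (UNIV :: 'n set) \<longrightarrow> X $ i $ j = 0" by simp
  obtain S :: "'n set" and u where uK: "\<forall>k\<in>S. vec_K K (u k)"
    and Xu: "\<forall>i j. X $ i $ j = (\<Sum>k\<in>S. cnj (u k $ i) * u k $ j)" and inj: "inj_on u S"
    and ind: "vec.independent (u ` S)" and span: "vec.span (u ` S) = vec.span (rows X)"
    using cholesky_on[OF finite[of UNIV] assms zero] by blast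
  define C :: "complex^'n^'n" where "C = (\<chi> i k. if k \<in> S then cnj (u k $ i) else 0)"
  have "rank X = vec.dim (vec.span (rows X))"
    by (simp add: row_rank_def_gen vec.dim_span)
  also have "\<dots> = card (u ` S)"
    unfolding span[symmetric] by (simp add: vec.dim_span vec.dim_eq_card_independent[OF ind])
  also have "\<dots> = card S" by (rule card_image[OF inj])
  finally have "card S = rank X" ..
  moreover have "mat_K K C" using uK by (auto simp: mat_K_def C_def vec_K_def)
  moreover have "X = C ** ctrans C"
    by (simp add: vec_eq_iff Xu matrix_matrix_mult_def C_def if_distrib[of cnj] mult_delta_left
        mult_delta_right) (auto intro!: sum.mono_neutral_cong_left)
  moreover have "k \<notin> S \<Longrightarrow> C $ i $ k = 0" for i k by (simp add: C_def)
  ultimately show ?thesis using that by blast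
qed

section \<open>Expected logarithm from the Laplace transform\<close>

text \<open>The Gamma integral under the substitution \<open>s \<mapsto> q * s\<close>. Read from
  right to left it represents \<open>q powr (- p)\<close> as a mixture of exponentials in
  \<open>q\<close>, which is how negative moments are reached from a Laplace transform.\<close>

lemma nn_integral_powr_mult_exp:
  fixes p q :: real
  assumes p: "p > 0" and q: "q > 0"
  shows "(\<integral>\<^sup>+s. ennreal (indicator {0..} s * s powr (p - 1) * exp (- (s * q))) \<partial>lborel)
    = ennreal (Gamma p * q powr (- p))"
proof -
  let ?f = "\<lambda>s. ennreal (indicator {0..} s * s powr (p - 1) * exp (- (s * q)))"
  have "ennreal (Gamma p) = (\<integral>\<^sup>+s. ennreal (indicator {0..} s * s powr (p - 1) / exp s) \<partial>lborel)"
    by (rule Gamma_conv_nn_integral_real[OF p])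
  also have "\<dots> = ennreal q *
      (\<integral>\<^sup>+s. ennreal (indicator {0..} (q * s) * (q * s) powr (p - 1) / exp (q * s)) \<partial>lborel)"
    using q by (subst nn_integral_real_affine[where c = q and t = 0]) auto
  also have "(\<integral>\<^sup>+s. ennreal (indicator {0..} (q * s) * (q * s) powr (p - 1) / exp (q * s)) \<partial>lborel)
      = (\<integral>\<^sup>+s. ennreal (q powr (p - 1)) * ?f s \<partial>lborel)"
    using q by (intro nn_integral_cong)
      (auto simp: indicator_def zero_le_mult_iff powr_mult ennreal_mult'[symmetric] exp_minus field_simps)
  also have "\<dots> = ennreal (q powr (p - 1)) * integral\<^sup>N lborel ?f"
    by (rule nn_integral_cmult) simp
  finally have "ennreal (Gamma p) = ennreal (q powr p) * integral\<^sup>N lborel ?f"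
    using q by (simp add: mult.assoc[symmetric] ennreal_mult'[symmetric] powr_mult_base)
  then have "ennreal (q powr (- p)) * ennreal (Gamma p)
      = ennreal (q powr (- p)) * ennreal (q powr p) * integral\<^sup>N lborel ?f"
    by (simp add: mult.assoc)
  also have "ennreal (q powr (- p)) * ennreal (q powr p) = 1"
    using q by (simp add: ennreal_mult'[symmetric] powr_add[symmetric])
  finally show ?thesis using p by (simp add: ennreal_mult'[symmetric] mult.commute)
qed

text \<open>A Beta integral, derived from Gamma integrals alone: write
  \<open>(1 + c * s) powr (- a)\<close> as a Gamma integral in \<open>y\<close>, exchange the
  integrals and integrate over \<open>s\<close> first. What remains is the integral for
  \<open>Gamma (a - p)\<close>, whence \<open>p < a\<close>.\<close>

lemma nn_integral_powr_mult_binomial: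
  fixes a c p :: real
  assumes a: "p < a" and c: "c > 0" and p: "p > 0"
  shows "(\<integral>\<^sup>+s. ennreal (indicator {0..} s * s powr (p - 1) * (1 + c * s) powr (- a)) \<partial>lborel)
    = ennreal (c powr (- p) * Gamma p * Gamma (a - p) / Gamma a)"
proof -
  let ?I = "indicator {0..} :: real \<Rightarrow> real"
  let ?J = "\<integral>\<^sup>+s. ennreal (?I s * s powr (p - 1) * (1 + c * s) powr (- a)) \<partial>lborel"
  have a0: "a > 0" using a p by simp
  have gz: "Gamma a \<noteq> 0" using Gamma_real_pos[OF a0] by linarith
  have inner: "ennreal (Gamma a) * ennreal (?I s * s powr (p - 1) * (1 + c * s) powr (- a))
      = (\<integral>\<^sup>+y. ennreal (?I s * s powr (p - 1) * (?I y * y powr (a - 1) * exp (- (y * (1 + c * s))))) \<partial>lborel)" for s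
  proof (cases "s \<ge> 0")
    case True
    then have "(\<integral>\<^sup>+y. ennreal (?I s * s powr (p - 1) * (?I y * y powr (a - 1) * exp (- (y * (1 + c * s))))) \<partial>lborel)
      = ennreal (s powr (p - 1)) * (\<integral>\<^sup>+y. ennreal (?I y * y powr (a - 1) * exp (- (y * (1 + c * s)))) \<partial>lborel)"
      by (subst nn_integral_cmult[symmetric]) (auto simp: ennreal_mult'[symmetric])
    also have "\<dots> = ennreal (s powr (p - 1)) * ennreal (Gamma a * (1 + c * s) powr (- a))"
      using a0 c True by (subst nn_integral_powr_mult_exp) (auto simp: add_pos_nonneg)
    finally show ?thesis using True a0 by (simp add: ennreal_mult'[symmetric] mult_ac)
  qed simp
  have "ennreal (Gamma a) * ?J = (\<integral>\<^sup>+s. ennreal (Gamma a) * ennreal (?I s * s powr (p - 1) * (1 + c * s) powr (- a)) \<partial>lborel)"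
    by (rule nn_integral_cmult[symmetric]) simp
  also have "\<dots> = (\<integral>\<^sup>+s. \<integral>\<^sup>+y. ennreal (?I s * s powr (p - 1) * (?I y * y powr (a - 1) * exp (- (y * (1 + c * s))))) \<partial>lborel \<partial>lborel)"
    by (simp only: inner)
  also have "\<dots> = (\<integral>\<^sup>+y. \<integral>\<^sup>+s. ennreal (?I s * s powr (p - 1) * (?I y * y powr (a - 1) * exp (- (y * (1 + c * s))))) \<partial>lborel \<partial>lborel)"
    by (rule lborel_pair.Fubini') simp
  also have "\<dots> = (\<integral>\<^sup>+y. ennreal (Gamma p * c powr (- p)) * ennreal (?I y * y powr (a - p - 1) * exp (- (y * 1))) \<partial>lborel)"
  proof (rule nn_integral_cong)
    fix y :: real
    show "(\<integral>\<^sup>+s. ennreal (?I s * s powr (p - 1) * (?I y * y powr (a - 1) * exp (- (y * (1 + c * s))))) \<partial>lborel)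
      = ennreal (Gamma p * c powr (- p)) * ennreal (?I y * y powr (a - p - 1) * exp (- (y * 1)))"
    proof (cases "y > 0")
      case True
      have "(\<integral>\<^sup>+s. ennreal (?I s * s powr (p - 1) * (?I y * y powr (a - 1) * exp (- (y * (1 + c * s))))) \<partial>lborel)
        = (\<integral>\<^sup>+s. ennreal (y powr (a - 1) * exp (- y)) * ennreal (?I s * s powr (p - 1) * exp (- (s * (c * y)))) \<partial>lborel)"
        using True by (intro nn_integral_cong)
          (simp add: ennreal_mult'[symmetric] ring_distribs exp_add exp_diff exp_minus field_simps)
      also have "\<dots> = ennreal (y powr (a - 1) * exp (- y)) * ennreal (Gamma p * (c * y) powr (- p))"
        using True c p by (subst nn_integral_cmult) (simp_all add: nn_integral_powr_mult_exp)
      also have "y powr (a - 1) * exp (- y) * (Gamma p * (c * y) powr (- p))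
        = Gamma p * c powr (- p) * (y powr (a - p - 1) * exp (- y))"
      proof -
        have "y powr (a - p - 1) = y powr (a - 1) * y powr (- p)"
          by (simp add: powr_add[symmetric] algebra_simps)
        then show ?thesis using True c by (simp add: powr_mult)
      qed
      then have "ennreal (y powr (a - 1) * exp (- y)) * ennreal (Gamma p * (c * y) powr (- p))
        = ennreal (Gamma p * c powr (- p)) * ennreal (?I y * y powr (a - p - 1) * exp (- (y * 1)))"
        using True p by (simp add: ennreal_mult'[symmetric] mult_ac)
      finally show ?thesis .
    qed (auto simp: indicator_def)
  qed
  also have "\<dots> = ennreal (Gamma p * c powr (- p)) * ennreal (Gamma (a - p) * 1 powr (- (a - p)))"
    using a by (subst nn_integral_cmult) (simp_all only: nn_integral_powr_mult_exp diff_gt_0_iff_gt zero_less_one, simp_all)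
  finally have "ennreal (1 / Gamma a) * (ennreal (Gamma a) * ?J)
      = ennreal (1 / Gamma a) * (ennreal (Gamma p * c powr (- p)) * ennreal (Gamma (a - p)))" by simp
  also have "ennreal (1 / Gamma a) * (ennreal (Gamma a) * ?J) = ?J"
    using a0 gz by (simp add: mult.assoc[symmetric] ennreal_mult'[symmetric])
  finally show ?thesis
    using a p a0 Gamma_real_pos[of a] by (simp add: ennreal_mult'[symmetric] mult_ac)
qed

text \<open>The function \<open>p \<mapsto> q powr (- p)\<close> is convex with value 1 at 0, so its
  chord slopes from 0 increase; the quotient is minus such a slope.\<close>

lemma decreasing_powr_quotient:
  fixes q s t :: real
  assumes "q > 0" "0 < s" "s \<le> t"
  shows "(1 - q powr (- t)) / t \<le> (1 - q powr (- s)) / s"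
proof -
  have "exp ((1 - s / t) *\<^sub>R 0 + (s / t) *\<^sub>R (- t * ln q)) \<le> (1 - s / t) * exp 0 + (s / t) * exp (- t * ln q)"
    using assms by (intro convex_onD[OF exp_convex]) auto
  then have "q powr (- s) \<le> (1 - s / t) + (s / t) * q powr (- t)"
    using assms by (simp add: powr_def)
  then have "(s / t) * (1 - q powr (- t)) \<le> 1 - q powr (- s)" by (simp add: algebra_simps)
  then show ?thesis using assms by (simp add: field_simps)
qed

lemma powr_quotient_tendsto_ln:
  fixes q :: real
  assumes "q > 0"
  shows "((\<lambda>p. (1 - q powr (- p)) / p) \<longlongrightarrow> ln q) (at_right 0)"
proof -
  have "((\<lambda>p. q powr (- p)) has_real_derivative - ln q) (at 0)"
    using assms by (auto intro!: derivative_eq_intros)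
  then have "((\<lambda>p. (q powr (- p) - 1) / p) \<longlongrightarrow> - ln q) (at 0)"
    using assms by (simp add: DERIV_def)
  from tendsto_minus[OF this] have "((\<lambda>p. (1 - q powr (- p)) / p) \<longlongrightarrow> ln q) (at 0)"
    by (simp add: minus_divide_left)
  then show ?thesis by (rule filterlim_mono) (auto simp: at_le)
qed

lemma Gamma_quotient_tendsto:
  fixes a c :: real
  assumes "a > 0" "c > 0"
  shows "((\<lambda>p. (1 - c powr (- p) * Gamma (a - p) / Gamma a) / p) \<longlongrightarrow> Digamma a + ln c) (at_right 0)"
proof -
  have "a \<notin> \<int>\<^sub>\<le>\<^sub>0" using assms by (auto elim!: nonpos_Ints_cases)
  moreover have gz: "Gamma a \<noteq> 0" using Gamma_real_pos[OF assms(1)] by linarith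
  ultimately have "((\<lambda>p. c powr (- p) * Gamma (a - p) / Gamma a) has_real_derivative - (Digamma a + ln c)) (at 0)"
    using assms by (auto intro!: derivative_eq_intros simp: field_simps)
  then have "((\<lambda>p. (c powr (- p) * Gamma (a - p) / Gamma a - 1) / p) \<longlongrightarrow> - (Digamma a + ln c)) (at 0)"
    using assms gz by (simp add: DERIV_def)
  from tendsto_minus[OF this] have "((\<lambda>p. (1 - c powr (- p) * Gamma (a - p) / Gamma a) / p) \<longlongrightarrow> Digamma a + ln c) (at 0)"
    by (simp add: minus_divide_left add.commute)
  then show ?thesis by (rule filterlim_mono) (auto simp: at_le)
qed

text \<open>A nonnegative variable with the Laplace transform of a Gamma distribution has the negative
  moments of that distribution; these determine the expected logarithm because
  \<open>(1 - q powr (- p)) / p\<close> increases to \<open>ln q\<close> as \<open>p\<close> decreases to \<open>0\<close>.\<close>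
locale gamma_laplace = prob_space M for M :: "'a measure" +
  fixes Q :: "'a \<Rightarrow> real" and a c :: real
  assumes Q_measurable [measurable]: "Q \<in> borel_measurable M"
    and Q_nonneg: "\<And>x. 0 \<le> Q x" and a_pos: "a > 0" and c_pos: "c > 0"
    and laplace: "\<And>s. s > 0 \<Longrightarrow> (\<integral>\<^sup>+x. ennreal (exp (- (s * Q x))) \<partial>M) = ennreal ((1 + c * s) powr (- a))"
begin

text \<open>Where \<open>Q x = 0\<close> the Laplace integrand is 1, so the mass of that set is at
  most \<open>(1 + c * s) powr (- a)\<close> for every \<open>s > 0\<close>, and this tends to 0.
  Afterwards the default values of \<open>ln\<close> and \<open>powr\<close> at 0 can be
  ignored.\<close>

lemma AE_pos: "AE x in M. Q x > 0"
proof -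
  let ?N = "{x \<in> space M. Q x = 0}"
  have N [measurable]: "?N \<in> sets M" by measurable
  have le: "measure M ?N \<le> (1 + c * s) powr (- a)" if "s > 0" for s
  proof -
    have "emeasure M ?N = (\<integral>\<^sup>+x. indicator ?N x \<partial>M)" by simp
    also have "\<dots> \<le> (\<integral>\<^sup>+x. ennreal (exp (- (s * Q x))) \<partial>M)"
      by (intro nn_integral_mono) (auto simp: indicator_def)
    finally show ?thesis using laplace[OF that] by (simp add: emeasure_eq_measure)
  qed
  have "((\<lambda>s. (1 + c * s) powr (- a)) \<longlongrightarrow> 0) at_top"
    using a_pos c_pos by real_asymp
  then have "measure M ?N \<le> 0"
    by (rule tendsto_lowerbound)
       (use le in \<open>auto intro: eventually_mono[OF eventually_gt_at_top[of 0]]\<close>)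
  then have "measure M ?N = 0" by (simp add: measure_le_0_iff)
  then have "AE x in M. x \<notin> ?N"
    using N by (intro AE_not_in) (simp add: null_sets_def emeasure_eq_measure)
  then show ?thesis using AE_space
    by eventually_elim (use Q_nonneg in \<open>auto simp: less_le\<close>)
qed

lemma nn_integral_negative_moment:
  assumes p: "0 < p" "p < a"
  shows "(\<integral>\<^sup>+x. ennreal (Q x powr (- p)) \<partial>M) = ennreal (c powr (- p) * Gamma (a - p) / Gamma a)"
proof -
  let ?I = "indicator {0..} :: real \<Rightarrow> real"
  interpret pair_sigma_finite M "lborel :: real measure" ..
  have G: "Gamma p > 0" using p by simp
  have "ennreal (Gamma p) * (\<integral>\<^sup>+x. ennreal (Q x powr (- p)) \<partial>M)
      = (\<integral>\<^sup>+x. ennreal (Gamma p * Q x powr (- p)) \<partial>M)"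
    using G by (subst nn_integral_cmult[symmetric]) (auto simp: ennreal_mult'[symmetric])
  also have "\<dots> = (\<integral>\<^sup>+x. \<integral>\<^sup>+s. ennreal (?I s * s powr (p - 1) * exp (- (s * Q x))) \<partial>lborel \<partial>M)"
    using AE_pos by (intro nn_integral_cong_AE) (auto elim!: eventually_mono simp: nn_integral_powr_mult_exp p)
  also have "\<dots> = (\<integral>\<^sup>+s. \<integral>\<^sup>+x. ennreal (?I s * s powr (p - 1) * exp (- (s * Q x))) \<partial>M \<partial>lborel)"
    by (rule Fubini'[symmetric]) simp
  also have "\<dots> = (\<integral>\<^sup>+s. ennreal (?I s * s powr (p - 1) * (1 + c * s) powr (- a)) \<partial>lborel)"
  proof (rule nn_integral_cong)
    fix s :: real
    show "(\<integral>\<^sup>+x. ennreal (?I s * s powr (p - 1) * exp (- (s * Q x))) \<partial>M)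
        = ennreal (?I s * s powr (p - 1) * (1 + c * s) powr (- a))"
    proof (cases "s > 0")
      case True
      then show ?thesis
        by (simp add: ennreal_mult' nn_integral_cmult laplace)
    qed (auto simp: indicator_def)
  qed
  also have "\<dots> = ennreal (c powr (- p) * Gamma p * Gamma (a - p) / Gamma a)"
    by (rule nn_integral_powr_mult_binomial) (use p c_pos in auto)
  finally have "ennreal (1 / Gamma p) * (ennreal (Gamma p) * (\<integral>\<^sup>+x. ennreal (Q x powr (- p)) \<partial>M))
      = ennreal (1 / Gamma p) * ennreal (c powr (- p) * Gamma p * Gamma (a - p) / Gamma a)" by simp
  then show ?thesis using G by (simp add: mult.assoc[symmetric] ennreal_mult'[symmetric])
qed

lemma has_bochner_integral_negative_moment:
  assumes p: "0 < p" "p < a"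
  shows "has_bochner_integral M (\<lambda>x. Q x powr (- p)) (c powr (- p) * Gamma (a - p) / Gamma a)"
  by (rule has_bochner_integral_nn_integral)
     (use nn_integral_negative_moment[OF p] p a_pos in auto)

theorem has_bochner_integral_ln: "has_bochner_integral M (\<lambda>x. ln (Q x)) (Digamma a + ln c)"
proof -
  \<comment> \<open>Shifting \<open>1 / n\<close> by this \<open>N\<close> puts every exponent below
    \<open>a\<close>, so all negative moments in the sequence are finite.\<close>
  obtain N :: nat where N: "1 / a < real N" using reals_Archimedean2 by blast
  have N0: "N > 0" using N a_pos by (intro gr0I) auto
  define p where "p n = 1 / real (n + N)" for n
  have p: "0 < p n" "p n < a" for n
  proof -
    show "0 < p n" using N0 by (simp add: p_def)
    have "1 / a < real (n + N)" using N by simp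
    then show "p n < a" using N0 a_pos by (simp add: p_def field_simps)
  qed
  have p_lim: "filterlim p (at_right 0) sequentially"
  proof -
    have "p \<longlonglongrightarrow> 0"
      unfolding p_def by (rule LIMSEQ_ignore_initial_segment[OF lim_1_over_n])
    then show ?thesis using p(1) by (simp add: filterlim_at eventually_sequentially less_imp_neq[symmetric])
  qed
  show ?thesis
  proof (rule has_bochner_integral_monotone_convergence[where f = "\<lambda>n x. (1 - Q x powr (- p n)) / p n"])
    show "integrable M (\<lambda>x. (1 - Q x powr (- p n)) / p n)" for n
      using has_bochner_integral_negative_moment[OF p, of n] by (simp add: has_bochner_integral_iff)
    show "AE x in M. mono (\<lambda>n. (1 - Q x powr (- p n)) / p n)"
      using AE_pos
    proof eventually_elim
      fix x assume "Q x > 0"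
      moreover have "p n \<le> p m" if "m \<le> n" for m n
        using that N0 by (simp add: p_def field_simps)
      ultimately show "mono (\<lambda>n. (1 - Q x powr (- p n)) / p n)"
        using p by (intro monoI decreasing_powr_quotient) auto
    qed
    show "AE x in M. (\<lambda>n. (1 - Q x powr (- p n)) / p n) \<longlonglongrightarrow> ln (Q x)"
      using AE_pos by eventually_elim (rule filterlim_compose[OF powr_quotient_tendsto_ln p_lim])
    have "integral\<^sup>L M (\<lambda>x. (1 - Q x powr (- p n)) / p n)
        = (1 - c powr (- p n) * Gamma (a - p n) / Gamma a) / p n" for n
      using has_bochner_integral_negative_moment[OF p, of n] by (simp add: has_bochner_integral_iff prob_space)
    then show "(\<lambda>n. integral\<^sup>L M (\<lambda>x. (1 - Q x powr (- p n)) / p n)) \<longlonglongrightarrow> Digamma a + ln c"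
      by (simp only: filterlim_compose[OF Gamma_quotient_tendsto[OF a_pos c_pos] p_lim])
  qed simp
qed

end

section \<open>Rotation invariance of the Gaussian noise\<close>

text \<open>Both measures are translation invariant; comparing them through a double integral
  against the indicator of the unit ball, which they weigh equally, shows that they agree.\<close>
lemma lborel_distr_orthogonal:
  fixes T :: "'a::euclidean_space \<Rightarrow> 'a"
  assumes T: "orthogonal_transformation T"
  shows "distr lborel borel T = lborel"
proof (rule measure_eqI)
  fix A assume "A \<in> sets (distr lborel borel T)"
  then have A [measurable]: "A \<in> sets borel" by simp
  have lin: "linear T" and nrm: "\<And>x. norm (T x) = norm x"
    using T by (auto simp: orthogonal_transformation)
  have [measurable]: "T \<in> borel_measurable borel"
    using lin by (intro borel_measurable_continuous_onI linear_continuous_on linear_conv_bounded_linear[THEN iffD1])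
  obtain T' where T': "\<And>x. T (T' x) = x"
    using orthogonal_transformation_surj[OF T] by (metis surjD)
  define B :: "'a \<Rightarrow> ennreal" where "B = indicator (ball 0 1)"
  define g :: "'a \<Rightarrow> ennreal" where "g = indicator A"
  have [measurable]: "B \<in> borel_measurable borel" "g \<in> borel_measurable borel"
    unfolding B_def g_def by (auto intro!: borel_measurable_indicator)
  have shift: "(\<integral>\<^sup>+x. h (t + x) \<partial>lborel) = (\<integral>\<^sup>+x. h x \<partial>lborel)"
    if [measurable]: "h \<in> borel_measurable borel" for h :: "'a \<Rightarrow> ennreal" and t
    by (subst (2) lborel_distr_plus[of t, symmetric], subst nn_integral_distr) auto
  have "(\<integral>\<^sup>+x. B x \<partial>lborel) * (\<integral>\<^sup>+y. g (T y) \<partial>lborel) = (\<integral>\<^sup>+x. \<integral>\<^sup>+y. B x * g (T y) \<partial>lborel \<partial>lborel)"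
    by (simp add: nn_integral_cmult nn_integral_multc)
  also have "\<dots> = (\<integral>\<^sup>+x. \<integral>\<^sup>+y. B x * g (x + T y) \<partial>lborel \<partial>lborel)"
  proof (rule nn_integral_cong)
    fix x
    have "(\<integral>\<^sup>+y. B x * g (T y) \<partial>lborel) = (\<integral>\<^sup>+y. B x * g (T (T' x + y)) \<partial>lborel)"
      by (rule shift[symmetric]) measurable
    then show "(\<integral>\<^sup>+y. B x * g (T y) \<partial>lborel) = (\<integral>\<^sup>+y. B x * g (x + T y) \<partial>lborel)"
      by (simp add: linear_add[OF lin] T')
  qed
  also have "\<dots> = (\<integral>\<^sup>+y. \<integral>\<^sup>+x. B x * g (x + T y) \<partial>lborel \<partial>lborel)"
    by (rule lborel_pair.Fubini') measurable
  also have "\<dots> = (\<integral>\<^sup>+y. \<integral>\<^sup>+x. B (x - T y) * g x \<partial>lborel \<partial>lborel)"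
  proof (rule nn_integral_cong)
    fix y
    have "(\<integral>\<^sup>+x. B (x - T y) * g x \<partial>lborel) = (\<integral>\<^sup>+x. B (T y + x - T y) * g (T y + x) \<partial>lborel)"
      by (rule shift[symmetric]) measurable
    then show "(\<integral>\<^sup>+x. B x * g (x + T y) \<partial>lborel) = (\<integral>\<^sup>+x. B (x - T y) * g x \<partial>lborel)"
      by (simp add: add.commute)
  qed
  also have "\<dots> = (\<integral>\<^sup>+x. \<integral>\<^sup>+y. B (x - T y) * g x \<partial>lborel \<partial>lborel)"
    by (rule lborel_pair.Fubini') measurable
  also have "\<dots> = (\<integral>\<^sup>+x. (\<integral>\<^sup>+y. B y \<partial>lborel) * g x \<partial>lborel)"
  proof (rule nn_integral_cong)
    fix x
    \<comment> \<open>\<open>B\<close> depends only on the norm and \<open>T\<close> is an isometry,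
      so as a function of \<open>y\<close> this is a translate of \<open>B\<close>.\<close>
    have "B (x - T y) = B (- T' x + y)" for y
    proof -
      have "norm (x - T y) = norm (T (T' x - y))" by (simp add: linear_diff[OF lin] T')
      also have "\<dots> = norm (- T' x + y)" by (simp add: nrm norm_minus_commute)
      finally show ?thesis by (simp add: B_def indicator_def)
    qed
    then show "(\<integral>\<^sup>+y. B (x - T y) * g x \<partial>lborel) = (\<integral>\<^sup>+y. B y \<partial>lborel) * g x"
      using shift[of B "- T' x"] by (simp add: nn_integral_multc)
  qed
  also have "\<dots> = (\<integral>\<^sup>+y. B y \<partial>lborel) * (\<integral>\<^sup>+x. g x \<partial>lborel)"
    by (simp add: nn_integral_cmult)
  finally have eq: "(\<integral>\<^sup>+x. B x \<partial>lborel) * (\<integral>\<^sup>+y. g (T y) \<partial>lborel) = (\<integral>\<^sup>+y. B y \<partial>lborel) * (\<integral>\<^sup>+x. g x \<partial>lborel)" .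
  have "(\<integral>\<^sup>+x. B x \<partial>lborel) = emeasure lborel (ball (0::'a) 1)"
    by (simp add: B_def)
  also have "\<dots> = ennreal (measure lborel (ball (0::'a) 1))"
    by (rule emeasure_eq_ennreal_measure) (use emeasure_lborel_ball_finite[of "0::'a" 1] in auto)
  finally have "(\<integral>\<^sup>+x. B x \<partial>lborel) = ennreal (measure lborel (ball (0::'a) 1))" .
  moreover have "measure lborel (ball (0::'a) 1) > 0" by (rule content_ball_pos) simp
  ultimately have "(\<integral>\<^sup>+y. g (T y) \<partial>lborel) = (\<integral>\<^sup>+x. g x \<partial>lborel)"
    using eq by (simp add: ennreal_mult_cancel_left)
  then have "(\<integral>\<^sup>+y. g y \<partial>distr lborel borel T) = (\<integral>\<^sup>+x. g x \<partial>lborel)"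
    by (simp add: nn_integral_distr)
  then show "emeasure (distr lborel borel T) A = emeasure lborel A"
    by (simp add: g_def)
qed simp

section \<open>The noise as a Gaussian density on Euclidean space\<close>

lemma measurable_vec_lambda_PiM:
  assumes "\<And>i. sets (M i) = sets borel"
  shows "(\<lambda>f. \<chi> i. f i) \<in> measurable (PiM UNIV M) (borel :: (real^'m) measure)"
proof (rule borel_measurable_euclidean_space[THEN iffD2], intro ballI)
  fix b :: "real^'m" assume "b \<in> Basis"
  then obtain i where b: "b = axis i 1" by (auto simp: Basis_vec_def)
  have "(\<lambda>f. f i) \<in> measurable (PiM UNIV M) (M i)" by simp
  also have "measurable (PiM UNIV M) (M i) = measurable (PiM UNIV M) borel"
    by (rule measurable_cong_sets) (simp_all add: assms)
  finally show "(\<lambda>f. (\<chi> i. f i) \<bullet> b) \<in> measurable (PiM UNIV M) borel"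
    by (simp add: b inner_axis)
qed

text \<open>The noise lives on functions over a finite index set, but orthogonal maps act on a
  vector type; this identifies the two Lebesgue measures. Agreement on boxes suffices.\<close>

lemma lborel_vec_eq_distr_PiM:
  "lborel = distr (PiM UNIV (\<lambda>_. lborel)) (borel :: (real^'m) measure) (\<lambda>f. \<chi> i. f i)"
proof (rule lborel_eqI)
  fix l u :: "real^'m"
  assume le: "\<And>b. b \<in> Basis \<Longrightarrow> l \<bullet> b \<le> u \<bullet> b"
  interpret product_sigma_finite "\<lambda>_::'m. lborel :: real measure" ..
  have le': "l $ i \<le> u $ i" for i
    using le[of "axis i 1"] by (auto simp: inner_axis Basis_vec_def)
  have pre: "(\<lambda>f. \<chi> i. f i) -` box l u \<inter> space (PiM UNIV (\<lambda>_::'m. lborel)) = Pi\<^sub>E UNIV (\<lambda>i. {l $ i <..< u $ i})"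
    by (auto simp: mem_box Basis_vec_def inner_axis space_PiM PiE_iff)
  have Basis: "(Basis :: (real^'m) set) = range (\<lambda>i. axis i 1)" by (auto simp: Basis_vec_def)
  have "emeasure (distr (PiM UNIV (\<lambda>_. lborel)) borel (\<lambda>f. \<chi> i. f i)) (box l u) = (\<Prod>i\<in>UNIV. ennreal (u $ i - l $ i))"
    by (subst emeasure_distr) (auto simp: pre emeasure_PiM measurable_vec_lambda_PiM le')
  also have "\<dots> = (\<Prod>b\<in>Basis. (u - l) \<bullet> b)"
    unfolding Basis by (subst prod.reindex) (auto simp: inj_on_def axis_eq_axis inner_axis prod_ennreal le')
  finally show "emeasure (distr (PiM UNIV (\<lambda>_. lborel)) borel (\<lambda>f. \<chi> i. f i)) (box l u) = (\<Prod>b\<in>Basis. (u - l) \<bullet> b)" .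
qed simp

lemma prob_space_std_normal: "prob_space (density lborel std_normal_density)"
  by (rule prob_space_normal_density) simp

lemma prob_space_gauss_noise: "prob_space gauss_noise"
  unfolding gauss_noise_def by (intro prob_space_PiM prob_space_std_normal)

lemma sets_gauss_noise [measurable_cong]: "sets gauss_noise = sets (PiM UNIV (\<lambda>_. borel))"
  unfolding gauss_noise_def by (intro sets_PiM_cong) auto

text \<open>Checked on rectangles, where both sides factor. The joint density is needed because
  rotation invariance is not visible coordinate by coordinate.\<close>

lemma gauss_noise_eq_density:
  "gauss_noise = density (PiM (UNIV :: ('n::finite \<times> bool) set) (\<lambda>_. lborel)) (\<lambda>g. \<Prod>p\<in>UNIV. ennreal (std_normal_density (g p)))"
  (is "_ = ?D")
proof -
  interpret product_prob_space "\<lambda>_::'n \<times> bool. density lborel std_normal_density"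
    by (simp add: product_prob_space_def product_prob_space_axioms_def product_sigma_finite_def prob_space_std_normal prob_space_imp_sigma_finite)
  interpret L: product_sigma_finite "\<lambda>_::'n \<times> bool. lborel :: real measure" ..
  have "?D = gauss_noise"
    unfolding gauss_noise_def
  proof (rule PiM_eqI)
    show "sets ?D = sets (PiM UNIV (\<lambda>_. density lborel std_normal_density))"
      by (simp, intro sets_PiM_cong) auto
    fix A :: "'n \<times> bool \<Rightarrow> real set"
    assume "\<And>p. p \<in> UNIV \<Longrightarrow> A p \<in> sets (density lborel (\<lambda>x. ennreal (std_normal_density x)))"
    then have A [measurable]: "A p \<in> sets borel" for p by simp
    have "emeasure ?D (Pi\<^sub>E UNIV A) = (\<integral>\<^sup>+g. (\<Prod>p\<in>UNIV. ennreal (std_normal_density (g p))) * indicator (Pi\<^sub>E UNIV A) g \<partial>PiM UNIV (\<lambda>_. lborel))"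
      by (rule emeasure_density) auto
    also have "\<dots> = (\<integral>\<^sup>+g. (\<Prod>p\<in>UNIV. ennreal (std_normal_density (g p)) * indicator (A p) (g p)) \<partial>PiM UNIV (\<lambda>_. lborel))"
    proof (rule nn_integral_cong)
      fix g :: "'n \<times> bool \<Rightarrow> real"
      have "(indicator (Pi\<^sub>E UNIV A) g :: ennreal) = (\<Prod>p\<in>UNIV. indicator (A p) (g p))"
      proof (cases "g \<in> Pi\<^sub>E UNIV A")
        case True
        then have "g p \<in> A p" for p by blast
        with True show ?thesis by simp
      next
        case False
        then obtain p where "g p \<notin> A p" by (auto simp: PiE_iff)
        then have "(\<Prod>p\<in>UNIV. indicator (A p) (g p) :: ennreal) = 0"
          by (intro prod_zero bexI[of _ p]) auto
        with False show ?thesis by simp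
      qed
      then show "(\<Prod>p\<in>UNIV. ennreal (std_normal_density (g p))) * indicator (Pi\<^sub>E UNIV A) g
          = (\<Prod>p\<in>UNIV. ennreal (std_normal_density (g p)) * indicator (A p) (g p))"
        by (simp add: prod.distrib)
    qed
    also have "\<dots> = (\<Prod>p\<in>UNIV. \<integral>\<^sup>+x. ennreal (std_normal_density x) * indicator (A p) x \<partial>lborel)"
      by (rule L.product_nn_integral_prod) auto
    also have "\<dots> = (\<Prod>p\<in>UNIV. emeasure (density lborel std_normal_density) (A p))"
      by (intro prod.cong) (auto simp: emeasure_density)
    finally show "emeasure ?D (Pi\<^sub>E UNIV A) = (\<Prod>p\<in>UNIV. emeasure (density lborel std_normal_density) (A p))" .
  qed simp
  then show ?thesis ..
qed

text \<open>The joint density is a function of the norm alone, hence unchanged by \<open>T\<close>,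
  and Lebesgue measure is invariant under \<open>T\<close>.\<close>

lemma gauss_noise_orthogonal_invariant:
  fixes T :: "real^('n::finite \<times> bool) \<Rightarrow> real^('n \<times> bool)"
  assumes T: "orthogonal_transformation T"
  shows "distr gauss_noise borel (\<lambda>g. T (\<chi> p. g p)) = distr gauss_noise borel (\<lambda>g. \<chi> p. g p)"
proof -
  let ?v = "\<lambda>g. \<chi> p. g p :: real^('n \<times> bool)"
  let ?P = "PiM (UNIV :: ('n \<times> bool) set) (\<lambda>_. lborel :: real measure)"
  define d :: "real^('n \<times> bool) \<Rightarrow> ennreal" where "d x = (\<Prod>p\<in>UNIV. ennreal (std_normal_density (x $ p)))" for x
  have lin: "linear T" and nrm: "\<And>x. norm (T x) = norm x"
    using T by (auto simp: orthogonal_transformation)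
  have [measurable]: "T \<in> borel_measurable borel"
    using lin by (intro borel_measurable_continuous_onI linear_continuous_on linear_conv_bounded_linear[THEN iffD1])
  have v [measurable]: "?v \<in> measurable gauss_noise borel" "?v \<in> measurable ?P borel"
    unfolding gauss_noise_def by (rule measurable_vec_lambda_PiM; simp)+
  have [measurable]: "(\<lambda>x. x $ p) \<in> borel_measurable (borel :: (real^('n \<times> bool)) measure)" for p
    by (intro borel_measurable_continuous_onI continuous_intros)
  have d [measurable]: "d \<in> borel_measurable borel" unfolding d_def by measurable
  have d_norm: "d x = ennreal ((1 / sqrt (2 * pi)) ^ CARD('n \<times> bool) * exp (- (norm x)\<^sup>2 / 2))" for x
  proof -
    have "(norm x)\<^sup>2 = (\<Sum>p\<in>UNIV. (x $ p)\<^sup>2)" by (simp add: norm_vec_def L2_set_def sum_nonneg)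
    then show ?thesis
      by (simp add: d_def prod_ennreal std_normal_density_def prod_dividef power_one_over exp_sum[symmetric] sum_negf sum_divide_distrib)
  qed
  have dT: "d (T x) = d x" for x by (simp only: d_norm nrm)
  have law: "distr gauss_noise borel ?v = density lborel d"
  proof -
    have "distr gauss_noise borel ?v = distr (density ?P (\<lambda>g. d (?v g))) borel ?v"
      by (simp add: gauss_noise_eq_density d_def)
    also have "\<dots> = density (distr ?P borel ?v) d"
      by (rule density_distr[symmetric]) auto
    finally show ?thesis by (simp add: lborel_vec_eq_distr_PiM[symmetric])
  qed
  have "distr gauss_noise borel (\<lambda>g. T (?v g)) = distr (distr gauss_noise borel ?v) borel T"
    by (subst distr_distr) (auto simp: comp_def)
  also have "\<dots> = distr (density lborel (\<lambda>x. d (T x))) borel T"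
    by (simp add: law dT)
  also have "\<dots> = density (distr lborel borel T) d"
    by (rule density_distr[symmetric]) auto
  also have "\<dots> = distr gauss_noise borel ?v"
    by (simp add: lborel_distr_orthogonal[OF T] law)
  finally show ?thesis .
qed

section \<open>The standard Gaussian vector\<close>

text \<open>\<open>std_gauss_vec\<close> read as a map on Euclidean vectors, the setting in which
  orthogonal maps act. Over the reals it projects away the coordinates
  \<open>(j, True)\<close>.\<close>

definition real_to_K :: "field_K \<Rightarrow> real^('n::finite \<times> bool) \<Rightarrow> complex^'n" where
  "real_to_K K v = (\<chi> j. case K of RealK \<Rightarrow> complex_of_real (v $ (j, False))
     | ComplexK \<Rightarrow> Complex (v $ (j, False)) (v $ (j, True)) / complex_of_real (sqrt 2))"

lemma std_gauss_vec_eq: "std_gauss_vec K g = real_to_K K (\<chi> p. g p)"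
  by (cases K) (simp_all add: std_gauss_vec_def real_to_K_def)

lemma borel_measurable_real_to_K [measurable]: "real_to_K K \<in> borel_measurable borel"
  unfolding real_to_K_def Complex_eq
  by (intro borel_measurable_continuous_onI continuous_on_vec_lambda, cases K)
     (auto intro!: continuous_intros)

lemma measurable_std_gauss_vec [measurable]:
  "(std_gauss_vec K :: _ \<Rightarrow> complex^'n::finite) \<in> measurable gauss_noise borel"
proof -
  have "(\<lambda>g. (\<chi> p. g p) :: real^('n \<times> bool)) \<in> measurable gauss_noise borel"
    unfolding gauss_noise_def by (rule measurable_vec_lambda_PiM) simp
  then show ?thesis unfolding std_gauss_vec_eq[abs_def] by measurable
qed

lemma borel_measurable_matrix_vector_mult [measurable]:
  "(\<lambda>x. M *v x) \<in> borel_measurable (borel :: (complex^'n) measure)" for M :: "complex^'n^'m"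
  unfolding matrix_vector_mult_def
  by (intro borel_measurable_continuous_onI continuous_on_vec_lambda continuous_intros)

lemma borel_measurable_vec_nth_complex [measurable]:
  "(\<lambda>x. x $ i) \<in> borel_measurable (borel :: (complex^'n) measure)"
  by (intro borel_measurable_continuous_onI continuous_intros)

lemma borel_measurable_vinner [measurable]:
  "(\<lambda>x. vinner b x) \<in> borel_measurable (borel :: (complex^'n) measure)"
  unfolding vinner_def by (intro borel_measurable_continuous_onI continuous_intros)

text \<open>\<open>V\<close> acts on real and imaginary parts as an orthogonal map \<open>T\<close>
  of the doubled real space, so the invariance of the noise applies. Over the complex numbers the
  factor \<open>1 / sqrt 2\<close> commutes with \<open>V\<close>; over the reals \<open>V\<close>
  has real entries, so \<open>T\<close> does not mix the two blocks and acts as \<open>V\<close> on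
  the one that is kept.\<close>

lemma std_gauss_vec_unitary_invariant:
  fixes V :: "complex^'n::finite^'n"
  assumes V: "unitary_K K V"
  shows "distr gauss_noise borel (\<lambda>g. V *v std_gauss_vec K g) = distr gauss_noise borel (std_gauss_vec K)"
proof -
  let ?v = "\<lambda>g. \<chi> p. g p :: real^('n \<times> bool)"
  have VK: "mat_K K V" using V by (simp add: unitary_K_def)
  define c :: "real^('n \<times> bool) \<Rightarrow> complex^'n" where "c x = (\<chi> j. Complex (x $ (j, False)) (x $ (j, True)))" for x
  define T :: "real^('n \<times> bool) \<Rightarrow> real^('n \<times> bool)" where
    "T x = (\<chi> p. if snd p then Im ((V *v c x) $ fst p) else Re ((V *v c x) $ fst p))" for x
  have cT: "c (T x) = V *v c x" for x
    by (simp add: c_def T_def vec_eq_iff complex_eq_iff)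
  have norm_c: "norm (c x) = norm x" for x
  proof -
    have "(norm x)\<^sup>2 = (\<Sum>p\<in>UNIV \<times> UNIV. (x $ p)\<^sup>2)"
      by (simp add: norm_vec_def L2_set_def sum_nonneg)
    also have "\<dots> = (\<Sum>j\<in>UNIV. (x $ (j, False))\<^sup>2 + (x $ (j, True))\<^sup>2)"
      by (subst sum.cartesian_product') (simp add: UNIV_bool)
    also have "\<dots> = (norm (c x))\<^sup>2"
      by (simp add: norm_vec_def L2_set_def sum_nonneg c_def cmod_power2)
    finally show ?thesis by simp
  qed
  have c_add: "c (x + y) = c x + c y" and c_scale: "c (r *\<^sub>R x) = of_real r *s c x" for x y r
    by (simp_all add: c_def vec_eq_iff complex_eq_iff)
  have "linear T"
    by (rule linearI)
       (simp_all add: T_def c_add c_scale vec_eq_iff matrix_vector_right_distrib vector_scalar_commute)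
  moreover have "norm (T x) = norm x" for x
    using norm_c[of "T x"] unitary_K_norm[OF V, of "c x"] by (simp add: cT norm_c)
  ultimately have orth: "orthogonal_transformation T" by (simp add: orthogonal_transformation)
  have sT: "real_to_K K (T x) = V *v real_to_K K x" for x
  proof (cases K)
    case RealK
    then have "Im (V $ i $ j) = 0" for i j using VK by (simp add: mat_K_def in_K_def)
    then show ?thesis
      by (simp add: RealK real_to_K_def vec_eq_iff complex_eq_iff T_def matrix_vector_mult_def c_def)
  next
    case ComplexK
    have "real_to_K K x = of_real (1 / sqrt 2) *s c x" for x
      by (simp add: ComplexK real_to_K_def c_def vec_eq_iff)
    then show ?thesis by (simp add: cT vector_scalar_commute)
  qed
  have v [measurable]: "?v \<in> measurable gauss_noise borel"
    unfolding gauss_noise_def by (rule measurable_vec_lambda_PiM) simp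
  have [measurable]: "T \<in> borel_measurable borel"
    using \<open>linear T\<close> by (intro borel_measurable_continuous_onI linear_continuous_on linear_conv_bounded_linear[THEN iffD1])
  have "distr gauss_noise borel (\<lambda>g. V *v std_gauss_vec K g) = distr (distr gauss_noise borel (\<lambda>g. T (?v g))) borel (real_to_K K)"
    by (subst distr_distr) (auto simp: comp_def sT std_gauss_vec_eq)
  also have "\<dots> = distr (distr gauss_noise borel ?v) borel (real_to_K K)"
    by (simp only: gauss_noise_orthogonal_invariant[OF orth])
  also have "\<dots> = distr gauss_noise borel (std_gauss_vec K)"
    by (subst distr_distr) (auto simp: comp_def std_gauss_vec_eq[abs_def])
  finally show ?thesis .
qed

lemma has_bochner_integral_std_gauss_vec_unitary:
  fixes F :: "complex^'n::finite \<Rightarrow> real"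
  assumes V: "unitary_K K V" and [measurable]: "F \<in> borel_measurable borel"
    and F: "has_bochner_integral gauss_noise (\<lambda>g. F (std_gauss_vec K g)) z"
  shows "has_bochner_integral gauss_noise (\<lambda>g. F (V *v std_gauss_vec K g)) z"
proof -
  have "integrable (distr gauss_noise borel (std_gauss_vec K)) F"
    "integral\<^sup>L (distr gauss_noise borel (std_gauss_vec K)) F = z"
    using F by (simp_all add: integrable_distr_eq integral_distr has_bochner_integral_iff)
  then show ?thesis
    unfolding std_gauss_vec_unitary_invariant[OF V, symmetric]
    by (simp add: integrable_distr_eq integral_distr has_bochner_integral_iff)
qed

lemma AE_std_gauss_vec_unitary:
  fixes P :: "complex^'n::finite \<Rightarrow> bool"
  assumes V: "unitary_K K V" and P: "{x. P x} \<in> sets borel"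
    and AE: "AE g in gauss_noise. P (std_gauss_vec K g)"
  shows "AE g in gauss_noise. P (V *v std_gauss_vec K g)"
proof -
  have "AE x in distr gauss_noise borel (std_gauss_vec K). P x"
    using AE P by (subst AE_distr_iff) auto
  then have "AE x in distr gauss_noise borel (\<lambda>g. V *v std_gauss_vec K g). P x"
    by (simp only: std_gauss_vec_unitary_invariant[OF V])
  then show ?thesis using P by (subst (asm) AE_distr_iff) auto
qed

section \<open>Gamma laws of Gaussian sums of squares\<close>

lemma nn_integral_exp_square_std_normal:
  fixes t :: real
  assumes "t \<ge> 0"
  shows "(\<integral>\<^sup>+x. ennreal (exp (- (t * x\<^sup>2))) \<partial>density lborel std_normal_density) = ennreal ((1 + 2 * t) powr (- (1 / 2)))"
proof -
  \<comment> \<open>The standard normal density times \<open>exp (- (t * x\<^sup>2))\<close> is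
    \<open>s\<close> times the centred normal density of standard deviation
    \<open>s\<close>.\<close>
  define s where "s = 1 / sqrt (1 + 2 * t)"
  have s: "s > 0" "s\<^sup>2 = 1 / (1 + 2 * t)" using assms by (auto simp: s_def power_divide)
  interpret prob_space "density lborel (normal_density 0 s)" using s by (rule_tac prob_space_normal_density)
  have "(\<integral>\<^sup>+x. ennreal (exp (- (t * x\<^sup>2))) \<partial>density lborel std_normal_density)
      = (\<integral>\<^sup>+x. ennreal (std_normal_density x) * ennreal (exp (- (t * x\<^sup>2))) \<partial>lborel)"
    by (subst nn_integral_density) auto
  also have "\<dots> = (\<integral>\<^sup>+x. ennreal s * ennreal (normal_density 0 s x) \<partial>lborel)"
  proof (rule nn_integral_cong)
    fix x :: real
    have "std_normal_density x * exp (- (t * x\<^sup>2)) = s * normal_density 0 s x"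
    proof -
      have "exp (- (x\<^sup>2 / 2)) * exp (- (t * x\<^sup>2)) = exp (- (x\<^sup>2 / (2 * s\<^sup>2)))"
        using assms by (simp add: exp_add[symmetric] s(2) algebra_simps)
      moreover have "sqrt (2 * pi * s\<^sup>2) = sqrt (2 * pi) * s"
        using s(1) by (simp add: real_sqrt_mult)
      ultimately show ?thesis
        using s(1) by (simp add: std_normal_density_def normal_density_def)
    qed
    then show "ennreal (std_normal_density x) * ennreal (exp (- (t * x\<^sup>2))) = ennreal s * ennreal (normal_density 0 s x)"
      using s(1) by (simp add: ennreal_mult'[symmetric])
  qed
  also have "\<dots> = ennreal s * emeasure (density lborel (normal_density 0 s)) UNIV"
    by (simp add: nn_integral_cmult emeasure_density)
  also have "\<dots> = ennreal s" using emeasure_space_1 by simp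
  also have "s = (1 + 2 * t) powr (- (1 / 2))"
    using assms by (simp add: s_def powr_minus powr_half_sqrt inverse_eq_divide)
  finally show ?thesis .
qed

text \<open>By independence the Laplace transform is a product over coordinates: each one in
  \<open>P\<close> contributes \<open>(1 + 2 * w * s) powr (- (1 / 2))\<close>, each other one
  contributes 1. Hence the shape \<open>card P / 2\<close> and the scale
  \<open>2 * w\<close>.\<close>

lemma gamma_laplace_sum_squares:
  fixes P :: "('n::finite \<times> bool) set"
  assumes w: "w > 0" and P: "P \<noteq> {}"
  shows "gamma_laplace gauss_noise (\<lambda>g. w * (\<Sum>p\<in>P. (g p)\<^sup>2)) (real (card P) / 2) (2 * w)"
proof -
  interpret prob_space "gauss_noise :: ('n \<times> bool \<Rightarrow> real) measure" by (rule prob_space_gauss_noise)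
  interpret product_sigma_finite "\<lambda>_::'n \<times> bool. density lborel std_normal_density"
    by (simp add: product_sigma_finite_def prob_space_std_normal prob_space_imp_sigma_finite)
  show ?thesis
  proof
    fix s :: real assume s: "s > 0"
    have "(\<integral>\<^sup>+g. ennreal (exp (- (s * (w * (\<Sum>p\<in>P. (g p)\<^sup>2))))) \<partial>gauss_noise)
        = (\<integral>\<^sup>+g. (\<Prod>p\<in>UNIV. ennreal (if p \<in> P then exp (- (s * w * (g p)\<^sup>2)) else 1)) \<partial>gauss_noise)"
    proof (rule nn_integral_cong)
      fix g :: "'n \<times> bool \<Rightarrow> real"
      have "(\<Prod>p\<in>UNIV. if p \<in> P then exp (- (s * w * (g p)\<^sup>2)) else 1) = (\<Prod>p\<in>P. exp (- (s * w * (g p)\<^sup>2)))"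
        by (simp add: prod.If_cases)
      also have "\<dots> = exp (- (s * (w * (\<Sum>p\<in>P. (g p)\<^sup>2))))"
        by (simp add: exp_sum[symmetric] sum_negf sum_distrib_left mult.assoc)
      finally show "ennreal (exp (- (s * (w * (\<Sum>p\<in>P. (g p)\<^sup>2))))) = (\<Prod>p\<in>UNIV. ennreal (if p \<in> P then exp (- (s * w * (g p)\<^sup>2)) else 1))"
        by (subst prod_ennreal) auto
    qed
    also have "\<dots> = (\<Prod>p\<in>UNIV. \<integral>\<^sup>+x. ennreal (if p \<in> P then exp (- (s * w * x\<^sup>2)) else 1) \<partial>density lborel std_normal_density)"
      unfolding gauss_noise_def by (rule product_nn_integral_prod) auto
    also have "\<dots> = (\<Prod>p\<in>UNIV. if p \<in> P then ennreal ((1 + 2 * w * s) powr (- (1 / 2))) else 1)"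
      using nn_integral_exp_square_std_normal[of "s * w"] s w
      by (intro prod.cong) (auto simp: prob_space.emeasure_space_1[OF prob_space_std_normal, simplified] mult_ac)
    also have "\<dots> = ennreal ((1 + 2 * w * s) powr (- (1 / 2))) ^ card P"
      by (simp add: prod.If_cases)
    also have "\<dots> = ennreal ((1 + 2 * w * s) powr (- (real (card P) / 2)))"
    proof -
      have "1 + 2 * w * s > 0" using s w by (simp add: add_pos_pos)
      then show ?thesis by (simp add: ennreal_power powr_realpow[symmetric] powr_powr)
    qed
    finally show "(\<integral>\<^sup>+g. ennreal (exp (- (s * (w * (\<Sum>p\<in>P. (g p)\<^sup>2))))) \<partial>gauss_noise)
      = ennreal ((1 + 2 * w * s) powr (- (real (card P) / 2)))" .
  next
    show "(\<lambda>g. w * (\<Sum>p\<in>P. (g p)\<^sup>2)) \<in> borel_measurable gauss_noise" by measurable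
    show "0 < real (card P) / 2" using P by (simp add: card_gt_0_iff)
  qed (use w in \<open>auto intro!: mult_nonneg_nonneg sum_nonneg\<close>)
qed

text \<open>For positive \<open>r\<close>, the mean logarithm of a sum of \<open>r\<close>
  independent squared moduli of standard Gaussians over K: \<open>Digamma\<close> of the Gamma shape
  plus \<open>ln\<close> of the scale, which is 2 over the reals and 1 over the complex
  numbers.\<close>

definition mean_ln_gauss :: "field_K \<Rightarrow> nat \<Rightarrow> real" where
  "mean_ln_gauss K r = (case K of RealK \<Rightarrow> Digamma (real r / 2) + ln 2 | ComplexK \<Rightarrow> Digamma (real r))"

text \<open>The Euler-Mascheroni constant enters through \<open>mean_ln_gauss K 1\<close>: it is
  \<open>- Digamma 1\<close>, and \<open>Digamma (1 / 2)\<close> equals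
  \<open>Digamma 1 - 2 * ln 2\<close>.\<close>

lemma L_const_eq: "r > 0 \<Longrightarrow> L_const K r = mean_ln_gauss K r - ln (real r) - mean_ln_gauss K 1"
  by (cases K) (simp_all add: L_const_def mean_ln_gauss_def ln_div Digamma_one_half)

definition sqsum :: "'n set \<Rightarrow> complex^'n::finite \<Rightarrow> real" where
  "sqsum S x = (\<Sum>j\<in>S. (cmod (x $ j))\<^sup>2)"

lemma sqsum_nonneg: "0 \<le> sqsum S x"
  by (simp add: sqsum_def sum_nonneg)

lemma borel_measurable_sqsum [measurable]: "sqsum S \<in> borel_measurable borel"
  unfolding sqsum_def by measurable

lemma std_gauss_sqsum:
  fixes S :: "'n::finite set"
  assumes "S \<noteq> {}"
  shows AE_sqsum_pos: "AE g in gauss_noise. sqsum S (std_gauss_vec K g) > 0"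
    and has_bochner_integral_ln_sqsum: "has_bochner_integral gauss_noise (\<lambda>g. ln (sqsum S (std_gauss_vec K g))) (mean_ln_gauss K (card S))"
proof -
  \<comment> \<open>\<open>w\<close> is the square of the normalising factor of a real coordinate,
    and \<open>P\<close> collects the one or two real coordinates per index in \<open>S\<close>.
    With \<open>r = card S\<close>, shape and scale become \<open>r / 2\<close> and 2 over the
    reals, \<open>r\<close> and 1 over the complex numbers.\<close>
  define w where "w = (case K of RealK \<Rightarrow> 1 | ComplexK \<Rightarrow> (1 / 2 :: real))"
  define P :: "('n \<times> bool) set" where "P = S \<times> (case K of RealK \<Rightarrow> {False} | ComplexK \<Rightarrow> UNIV)"
  have "gamma_laplace gauss_noise (\<lambda>g. w * (\<Sum>p\<in>P. (g p)\<^sup>2)) (real (card P) / 2) (2 * w)"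
    by (rule gamma_laplace_sum_squares) (use assms in \<open>auto simp: w_def P_def split: field_K.split\<close>)
  moreover have "(\<lambda>g. w * (\<Sum>p\<in>P. (g p)\<^sup>2)) = (\<lambda>g. sqsum S (std_gauss_vec K g))"
  proof
    fix g :: "'n \<times> bool \<Rightarrow> real"
    show "w * (\<Sum>p\<in>P. (g p)\<^sup>2) = sqsum S (std_gauss_vec K g)"
      unfolding P_def sum.cartesian_product'
      by (cases K) (simp_all add: w_def sqsum_def std_gauss_vec_def UNIV_bool norm_divide cmod_power2 power_divide sum_divide_distrib
         add.commute)
  qed
  ultimately interpret gamma_laplace gauss_noise "\<lambda>g. sqsum S (std_gauss_vec K g)" "real (card P) / 2" "2 * w"
    by simp
  show "AE g in gauss_noise. sqsum S (std_gauss_vec K g) > 0" by (rule AE_pos)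
  show "has_bochner_integral gauss_noise (\<lambda>g. ln (sqsum S (std_gauss_vec K g))) (mean_ln_gauss K (card S))"
    using has_bochner_integral_ln
    by (cases K) (simp_all add: P_def w_def mean_ln_gauss_def card_cartesian_product UNIV_bool)
qed

section \<open>Logarithms and ratios of Gaussian quadratic forms\<close>

lemma vec_K_of_real_axis: "vec_K K (of_real c *s axis j 1)"
  by (intro vec_K_scale vec_K_axis) simp

lemma vinner_scaled_axis_self:
  "vinner (of_real c *s axis j 1) (of_real c *s axis j 1) = of_real (c\<^sup>2)"
  by (simp add: vinner_scale_left vinner_scale_right vinner_axis_left power2_eq_square)

lemma unitary_to_axis:
  assumes "vec_K K b"
  obtains V where "unitary_K K V" "V *v b = of_real (norm b) *s axis j 1"
proof -
  have "vinner b b = vinner (of_real (norm b) *s axis j 1) (of_real (norm b) *s axis j 1)"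
    by (simp only: vinner_self[of b] vinner_scaled_axis_self)
  from householder_exists[OF assms vec_K_of_real_axis this] that show ?thesis by blast
qed

text \<open>A unitary taking \<open>b\<close> to \<open>norm b\<close> times an axis vector turns
  the normalised linear form into a single Gaussian coordinate, so its law does not depend on
  \<open>b\<close>. The axis \<open>j\<close> is arbitrary.\<close>

lemma has_bochner_integral_ln_vinner:
  fixes b :: "complex^'n::finite"
  assumes b: "vec_K K b" "b \<noteq> 0"
  shows "AE g in gauss_noise. vinner b (std_gauss_vec K g) \<noteq> 0"
    and "has_bochner_integral gauss_noise
      (\<lambda>g. ln ((cmod (vinner b (std_gauss_vec K g)))\<^sup>2 / (norm b)\<^sup>2)) (mean_ln_gauss K 1)"
proof -
  obtain j :: 'n where True by simp
  obtain V where V: "unitary_K K V" "V *v b = of_real (norm b) *s axis j 1"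
    by (rule unitary_to_axis[OF b(1)])
  have eq: "(cmod (vinner b x))\<^sup>2 = (norm b)\<^sup>2 * sqsum {j} (V *v x)" for x
  proof -
    have "vinner b x = vinner (V *v b) (V *v x)" by (simp add: unitary_K_vinner[OF V(1)])
    then show ?thesis
      by (simp add: V(2) vinner_simps vinner_axis_left norm_mult power_mult_distrib sqsum_def)
  qed
  have "AE g in gauss_noise. sqsum {j} (V *v std_gauss_vec K g) > 0"
    by (rule AE_std_gauss_vec_unitary[OF V(1)]) (auto intro: AE_sqsum_pos)
  then show "AE g in gauss_noise. vinner b (std_gauss_vec K g) \<noteq> 0"
  proof eventually_elim
    fix g :: "'n \<times> bool \<Rightarrow> real" assume "sqsum {j} (V *v std_gauss_vec K g) > 0"
    then have "(cmod (vinner b (std_gauss_vec K g)))\<^sup>2 > 0"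
      unfolding eq using b by (intro mult_pos_pos) auto
    then show "vinner b (std_gauss_vec K g) \<noteq> 0" by auto
  qed
  have "has_bochner_integral gauss_noise (\<lambda>g. ln (sqsum {j} (V *v std_gauss_vec K g))) (mean_ln_gauss K 1)"
    using has_bochner_integral_ln_sqsum[of "{j}" K]
    by (intro has_bochner_integral_std_gauss_vec_unitary[OF V(1), where F = "\<lambda>x. ln (sqsum {j} x)"]) auto
  then show "has_bochner_integral gauss_noise
      (\<lambda>g. ln ((cmod (vinner b (std_gauss_vec K g)))\<^sup>2 / (norm b)\<^sup>2)) (mean_ln_gauss K 1)"
    using b by (simp add: eq)
qed

text \<open>The Householder map taking \<open>a\<close> to \<open>b\<close> changes only coordinates in \<open>S\<close>, so it preserves both the
  Gaussian law and \<open>sqsum S\<close>.\<close>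
lemma has_bochner_integral_ratio_transfer:
  fixes a b :: "complex^'n::finite"
  assumes K: "vec_K K a" "vec_K K b" and eq: "vinner a a = vinner b b"
    and supp: "\<And>j. j \<notin> S \<Longrightarrow> a $ j = 0" "\<And>j. j \<notin> S \<Longrightarrow> b $ j = 0"
    and int: "has_bochner_integral gauss_noise
      (\<lambda>g. (cmod (vinner b (std_gauss_vec K g)))\<^sup>2 / sqsum S (std_gauss_vec K g)) z"
  shows "has_bochner_integral gauss_noise
      (\<lambda>g. (cmod (vinner a (std_gauss_vec K g)))\<^sup>2 / sqsum S (std_gauss_vec K g)) z"
proof -
  obtain V where V: "unitary_K K V" "V *v a = b"
    and Vx: "\<And>x. \<exists>c. V *v x = x - (c * vinner (a - b) x) *s (a - b)"
    using householder_exists[OF K eq] by blast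
  have split: "(norm x)\<^sup>2 = sqsum S x + sqsum (- S) x" for x
  proof -
    have "(norm x)\<^sup>2 = (\<Sum>j\<in>S \<union> - S. (cmod (x $ j))\<^sup>2)"
      by (simp add: norm_vec_def L2_set_def sum_nonneg)
    also have "\<dots> = sqsum S x + sqsum (- S) x"
      unfolding sqsum_def by (rule sum.union_disjoint) auto
    finally show ?thesis .
  qed
  have sq: "sqsum S (V *v x) = sqsum S x" for x
  proof -
    have "(V *v x) $ j = x $ j" if "j \<in> - S" for j
      using Vx[of x] supp that by auto
    then have "sqsum (- S) (V *v x) = sqsum (- S) x" by (simp add: sqsum_def)
    then show ?thesis using split[of x] split[of "V *v x"] unitary_K_norm[OF V(1), of x] by simp
  qed
  have "vinner a x = vinner b (V *v x)" for x
    using unitary_K_vinner[OF V(1), of a x] by (simp add: V(2))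
  moreover have "has_bochner_integral gauss_noise
      (\<lambda>g. (cmod (vinner b (V *v std_gauss_vec K g)))\<^sup>2 / sqsum S (V *v std_gauss_vec K g)) z"
    by (rule has_bochner_integral_std_gauss_vec_unitary[OF V(1),
          where F = "\<lambda>x. (cmod (vinner b x))\<^sup>2 / sqsum S x"]) (simp_all add: int)
  ultimately show ?thesis by (simp add: sq)
qed

text \<open>The ratios over the indices in \<open>S\<close> sum to 1 almost surely and have equal
  means, by the transfer between axis vectors.\<close>

lemma has_bochner_integral_coordinate_ratio:
  fixes S :: "'n::finite set"
  assumes j: "j \<in> S"
  shows "has_bochner_integral gauss_noise
    (\<lambda>g. (cmod (std_gauss_vec K g $ j))\<^sup>2 / sqsum S (std_gauss_vec K g)) (1 / real (card S))"
proof -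
  let ?R = "\<lambda>j g. (cmod (std_gauss_vec K g $ j))\<^sup>2 / sqsum S (std_gauss_vec K g)"
  interpret prob_space "gauss_noise :: ('n \<times> bool \<Rightarrow> real) measure" by (rule prob_space_gauss_noise)
  have int: "integrable gauss_noise (?R k)" if "k \<in> S" for k
  proof (rule integrable_const_bound[where B = 1])
    have "(cmod (x $ k))\<^sup>2 \<le> sqsum S x" for x
      unfolding sqsum_def by (rule member_le_sum[OF that]) auto
    \<comment> \<open>The bound holds everywhere: where \<open>sqsum S\<close> vanishes the quotient
      is 0 by convention.\<close>
    then show "AE g in gauss_noise. norm (?R k g) \<le> 1"
      using sqsum_nonneg[of S] by (intro AE_I2) (auto simp: divide_le_eq_1 less_le)
  qed measurable
  have same: "integral\<^sup>L gauss_noise (?R k) = integral\<^sup>L gauss_noise (?R j)" if "k \<in> S" for k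
  proof -
    have "has_bochner_integral gauss_noise
      (\<lambda>g. (cmod (vinner (axis k 1) (std_gauss_vec K g)))\<^sup>2 / sqsum S (std_gauss_vec K g)) (integral\<^sup>L gauss_noise (?R j))"
    proof (rule has_bochner_integral_ratio_transfer[where b = "axis j 1"])
      show "vinner (axis k 1) (axis k 1) = vinner (axis j 1) (axis j 1)"
        by (simp add: vinner_axis_left)
    qed (use that j int[OF j] in \<open>auto simp: vec_K_axis vinner_axis_left has_bochner_integral_iff, auto simp: axis_def\<close>)
    then show ?thesis by (simp add: vinner_axis_left has_bochner_integral_iff)
  qed
  have "(\<Sum>k\<in>S. integral\<^sup>L gauss_noise (?R k)) = (\<integral>g. (\<Sum>k\<in>S. ?R k g) \<partial>gauss_noise)"
    using int by (subst Bochner_Integration.integral_sum) auto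
  also have "\<dots> = (\<integral>g. 1 \<partial>(gauss_noise :: ('n \<times> bool \<Rightarrow> real) measure))"
  proof (rule integral_cong_AE)
    have "S \<noteq> {}" using j by auto
    from AE_sqsum_pos[OF this, of K]
    show "AE g in gauss_noise. (\<Sum>k\<in>S. ?R k g) = 1"
      by eventually_elim (simp add: sum_divide_distrib[symmetric] sqsum_def[symmetric])
  qed measurable
  finally have "real (card S) * integral\<^sup>L gauss_noise (?R j) = 1"
    using same by (simp add: prob_space)
  moreover have "S \<noteq> {}" using j by auto
  ultimately show ?thesis using int[OF j]
    by (simp add: has_bochner_integral_iff eq_divide_eq mult.commute)
qed

text \<open>As \<open>b\<close> is supported in \<open>S\<close>, it can be rotated within these
  coordinates to \<open>norm b\<close> times an axis vector, which leaves a single coordinate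
  ratio.\<close>

lemma has_bochner_integral_vinner_ratio:
  fixes S :: "'n::finite set"
  assumes b: "vec_K K b" and supp: "\<And>j. j \<notin> S \<Longrightarrow> b $ j = 0" and S: "S \<noteq> {}"
  shows "has_bochner_integral gauss_noise
    (\<lambda>g. (cmod (vinner b (std_gauss_vec K g)))\<^sup>2 / sqsum S (std_gauss_vec K g)) ((norm b)\<^sup>2 / real (card S))"
proof -
  obtain j where j: "j \<in> S" using S by auto
  have "has_bochner_integral gauss_noise
    (\<lambda>g. (norm b)\<^sup>2 * ((cmod (std_gauss_vec K g $ j))\<^sup>2 / sqsum S (std_gauss_vec K g))) ((norm b)\<^sup>2 * (1 / real (card S)))"
    by (intro has_bochner_integral_mult_right has_bochner_integral_coordinate_ratio j)
  then have "has_bochner_integral gauss_noise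
    (\<lambda>g. (cmod (vinner (of_real (norm b) *s axis j 1) (std_gauss_vec K g)))\<^sup>2 / sqsum S (std_gauss_vec K g)) ((norm b)\<^sup>2 / real (card S))"
    by (simp add: vinner_simps vinner_axis_left norm_mult power_mult_distrib)
  then show ?thesis
  proof (rule has_bochner_integral_ratio_transfer[OF b vec_K_of_real_axis, rotated -1])
    show "vinner b b = vinner (of_real (norm b) *s axis j 1) (of_real (norm b) *s axis j 1)"
      by (simp only: vinner_self[of b] vinner_scaled_axis_self)
  qed (use j supp in \<open>auto simp: axis_def\<close>)
qed

section \<open>Squared norms of matrix images as sums over row forms, and bounds on their
  logarithms\<close>

definition crow :: "complex^'n^'m \<Rightarrow> 'm \<Rightarrow> complex^'n" where
  "crow M k = (\<chi> j. cnj (M $ k $ j))"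

lemma vinner_crow: "vinner (crow M k) x = (M *v x) $ k"
  by (simp add: vinner_def crow_def matrix_vector_mult_def)

lemma vec_K_crow: "mat_K K M \<Longrightarrow> vec_K K (crow M k)"
  by (simp add: mat_K_def vec_K_def crow_def)

lemma norm_mult_sq_eq_sum: "(norm (M *v x))\<^sup>2 = (\<Sum>k\<in>UNIV. (cmod (vinner (crow M k) x))\<^sup>2)"
  by (simp add: vinner_crow norm_vec_def L2_set_def sum_nonneg)

lemma sum_norm_crow: "(\<Sum>k\<in>UNIV. (norm (crow M k))\<^sup>2) = Re (trace (M ** ctrans M))"
proof -
  have "(norm (crow M k))\<^sup>2 = Re ((M ** ctrans M) $ k $ k)" for k
    by (simp add: crow_def norm_vec_def L2_set_def sum_nonneg matrix_matrix_mult_def cmod_power2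
        complex_mult_cnj)
  then show ?thesis by (simp add: trace_def)
qed

text \<open>The tangent of \<open>ln\<close> at the weighted mean \<open>s\<close> lies above
  \<open>ln\<close>, and its linear term averages to 0. Positivity of \<open>s\<close> is shown
  along the way, as the tangent divides by \<open>s\<close>.\<close>

lemma sum_mult_ln_le_ln_sum:
  fixes p y :: "'i \<Rightarrow> real"
  assumes "finite I" "\<And>i. i \<in> I \<Longrightarrow> p i \<ge> 0" "\<And>i. i \<in> I \<Longrightarrow> y i > 0" "(\<Sum>i\<in>I. p i) = 1"
  shows "(\<Sum>i\<in>I. p i * y i) > 0" "(\<Sum>i\<in>I. p i * ln (y i)) \<le> ln (\<Sum>i\<in>I. p i * y i)"
proof -
  define s where "s = (\<Sum>i\<in>I. p i * y i)"
  have "s \<ge> 0" using assms unfolding s_def by (intro sum_nonneg mult_nonneg_nonneg) (auto simp: less_imp_le)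
  moreover have "s \<noteq> 0"
  proof
    assume "s = 0"
    then have "\<forall>i\<in>I. p i * y i = 0"
      using assms unfolding s_def by (subst (asm) sum_nonneg_eq_0_iff) (auto simp: less_imp_le)
    then have "\<forall>i\<in>I. p i = 0" using assms(3) by (metis less_irrefl mult_eq_0_iff)
    then show False using assms(4) by simp
  qed
  ultimately have s: "s > 0" by simp
  then show "(\<Sum>i\<in>I. p i * y i) > 0" by (simp add: s_def)
  have "(\<Sum>i\<in>I. p i * ln (y i)) \<le> (\<Sum>i\<in>I. p i * (ln s + (y i / s - 1)))"
  proof (rule sum_mono, rule mult_left_mono)
    fix i assume i: "i \<in> I"
    have "ln (y i / s) \<le> y i / s - 1" using s assms(3)[OF i] by (intro ln_le_minus_one) simp
    then show "ln (y i) \<le> ln s + (y i / s - 1)" using s assms(3)[OF i] by (simp add: ln_div)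
  qed (use assms(2) in auto)
  also have "\<dots> = ln s * (\<Sum>i\<in>I. p i) + (\<Sum>i\<in>I. p i * y i) / s - (\<Sum>i\<in>I. p i)"
    by (simp add: algebra_simps sum.distrib sum_subtractf sum_distrib_left sum_divide_distrib)
  also have "\<dots> = ln s" using s assms(4) by (simp add: s_def[symmetric])
  finally show "(\<Sum>i\<in>I. p i * ln (y i)) \<le> ln (\<Sum>i\<in>I. p i * y i)" by (simp add: s_def)
qed

text \<open>Divided by \<open>t\<close>, the squared norm is a convex combination of normalised
  squared forms \<open>y k\<close>, weighted by the squared row norms. Each \<open>ln (y k)\<close>
  has mean \<open>mean_ln_gauss K 1\<close> whatever the row, so the dependence among the
  \<open>y k\<close> does no harm. The set \<open>I\<close> leaves out zero rows, where
  \<open>y k\<close> would be 0 / 0.\<close>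

lemma ln_norm_sq_minorant:
  fixes M :: "complex^'n::finite^'m::finite"
  assumes M: "mat_K K M" and t: "t = Re (trace (M ** ctrans M))" "t > 0"
  obtains f where "has_bochner_integral gauss_noise f (ln t + mean_ln_gauss K 1)"
    "AE g in gauss_noise. norm (M *v std_gauss_vec K g) > 0 \<and> f g \<le> ln ((norm (M *v std_gauss_vec K g))\<^sup>2)"
proof -
  interpret prob_space "gauss_noise :: ('n \<times> bool \<Rightarrow> real) measure" by (rule prob_space_gauss_noise)
  define I where "I = {k. crow M k \<noteq> 0}"
  define p where "p k = (norm (crow M k))\<^sup>2 / t" for k
  define y where "y k g = (cmod (vinner (crow M k) (std_gauss_vec K g)))\<^sup>2 / (norm (crow M k))\<^sup>2" for k and g :: "'n \<times> bool \<Rightarrow> real"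
  have p_sum: "(\<Sum>k\<in>I. p k) = 1"
  proof -
    have "(\<Sum>k\<in>I. p k) = (\<Sum>k\<in>UNIV. p k)"
      by (rule sum.mono_neutral_left) (auto simp: I_def p_def)
    also have "\<dots> = 1" using t sum_norm_crow[of M] by (simp add: p_def sum_divide_distrib[symmetric])
    finally show ?thesis .
  qed
  have norm_eq: "(norm (M *v std_gauss_vec K g))\<^sup>2 = t * (\<Sum>k\<in>I. p k * y k g)" for g
  proof -
    have "(norm (M *v std_gauss_vec K g))\<^sup>2 = (\<Sum>k\<in>I. (cmod (vinner (crow M k) (std_gauss_vec K g)))\<^sup>2)"
      unfolding norm_mult_sq_eq_sum by (rule sum.mono_neutral_right) (auto simp: I_def)
    also have "\<dots> = (\<Sum>k\<in>I. t * (p k * y k g))"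
      using t by (intro sum.cong) (auto simp: p_def y_def I_def)
    finally show ?thesis by (simp add: sum_distrib_left)
  qed
  define f where "f g = ln t + (\<Sum>k\<in>I. p k * ln (y k g))" for g
  have "has_bochner_integral gauss_noise f (ln t + (\<Sum>k\<in>I. p k * mean_ln_gauss K 1))"
    unfolding f_def y_def
    by (intro has_bochner_integral_add has_bochner_integral_sum has_bochner_integral_mult_right
        has_bochner_integral_ln_vinner(2) vec_K_crow M)
       (auto simp: I_def has_bochner_integral_iff prob_space)
  then have int: "has_bochner_integral gauss_noise f (ln t + mean_ln_gauss K 1)"
    by (simp add: sum_distrib_right[symmetric] p_sum)
  have "AE g in gauss_noise. \<forall>k\<in>I. vinner (crow M k) (std_gauss_vec K g) \<noteq> 0"
    by (intro AE_finite_allI has_bochner_integral_ln_vinner(1) vec_K_crow M) (auto simp: I_def)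
  then have "AE g in gauss_noise. norm (M *v std_gauss_vec K g) > 0 \<and> f g \<le> ln ((norm (M *v std_gauss_vec K g))\<^sup>2)"
  proof eventually_elim
    fix g :: "'n \<times> bool \<Rightarrow> real" assume g: "\<forall>k\<in>I. vinner (crow M k) (std_gauss_vec K g) \<noteq> 0"
    then have ypos: "y k g > 0" if "k \<in> I" for k using that by (auto simp: y_def I_def)
    note L = sum_mult_ln_le_ln_sum[of I p "\<lambda>k. y k g", OF _ _ ypos p_sum]
    have pos: "(\<Sum>k\<in>I. p k * y k g) > 0" by (rule L(1)) (use t in \<open>auto simp: p_def\<close>)
    have "(norm (M *v std_gauss_vec K g))\<^sup>2 > 0" unfolding norm_eq using pos t(2) by simp
    moreover have "f g \<le> ln ((norm (M *v std_gauss_vec K g))\<^sup>2)"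
      unfolding norm_eq f_def using pos t(2) L(2) by (simp add: ln_mult) (simp add: p_def)
    ultimately show "norm (M *v std_gauss_vec K g) > 0 \<and> f g \<le> ln ((norm (M *v std_gauss_vec K g))\<^sup>2)"
      by simp
  qed
  with int that show ?thesis by blast
qed

text \<open>Uses the tangent of the logarithm at \<open>sqsum S w / card S\<close>: the mean of the linear term vanishes.\<close>
lemma ln_norm_sq_majorant:
  fixes C :: "complex^'n::finite^'m::finite"
  assumes C: "mat_K K C" and tr: "Re (trace (C ** ctrans C)) = 1"
    and supp: "\<And>i k. k \<notin> S \<Longrightarrow> C $ i $ k = 0" and S: "S \<noteq> {}"
  obtains f where "has_bochner_integral gauss_noise f (mean_ln_gauss K (card S) - ln (real (card S)))"
    "AE g in gauss_noise. norm (C *v std_gauss_vec K g) > 0 \<longrightarrow> ln ((norm (C *v std_gauss_vec K g))\<^sup>2) \<le> f g"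
proof -
  interpret prob_space "gauss_noise :: ('n \<times> bool \<Rightarrow> real) measure" by (rule prob_space_gauss_noise)
  define r where "r = real (card S)"
  have r: "r > 0" using S by (simp add: r_def card_gt_0_iff)
  let ?q = "\<lambda>g. sqsum S (std_gauss_vec K g)"
  let ?N = "\<lambda>g. (norm (C *v std_gauss_vec K g))\<^sup>2"
  \<comment> \<open>Summing row by row, the squared row norms add up to the trace 1, so the ratio
    has mean \<open>1 / r\<close> without diagonalising anything.\<close>
  have "has_bochner_integral gauss_noise (\<lambda>g. \<Sum>k\<in>UNIV. (cmod (vinner (crow C k) (std_gauss_vec K g)))\<^sup>2 / ?q g)
      (\<Sum>k\<in>UNIV. (norm (crow C k))\<^sup>2 / r)"
    unfolding r_def
    by (intro has_bochner_integral_sum has_bochner_integral_vinner_ratio vec_K_crow C S) (auto simp: crow_def supp)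
  then have ratio: "has_bochner_integral gauss_noise (\<lambda>g. ?N g / ?q g) (1 / r)"
    by (simp add: norm_mult_sq_eq_sum sum_divide_distrib[symmetric] sum_norm_crow tr)
  define f where "f g = ln (?q g) + (r * (?N g / ?q g) + (- ln r - 1))" for g
  have "has_bochner_integral gauss_noise f (mean_ln_gauss K (card S) + (r * (1 / r) + (- ln r - 1)))"
    unfolding f_def
    by (intro has_bochner_integral_add has_bochner_integral_mult_right ratio has_bochner_integral_ln_sqsum S)
       (simp add: has_bochner_integral_iff prob_space)
  also have "mean_ln_gauss K (card S) + (r * (1 / r) + (- ln r - 1)) = mean_ln_gauss K (card S) - ln (real (card S))"
    using r by (simp add: r_def[symmetric])
  finally have "has_bochner_integral gauss_noise f (mean_ln_gauss K (card S) - ln (real (card S)))" .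
  \<comment> \<open>The premise excludes a vanishing image, where the default
    \<open>ln 0 = 0\<close> need not lie below \<open>f g\<close>.\<close>
  moreover have "AE g in gauss_noise. norm (C *v std_gauss_vec K g) > 0 \<longrightarrow> ln (?N g) \<le> f g"
    using AE_sqsum_pos[OF S, of K]
  proof eventually_elim
    fix g :: "'n \<times> bool \<Rightarrow> real" assume q: "?q g > 0"
    show "norm (C *v std_gauss_vec K g) > 0 \<longrightarrow> ln (?N g) \<le> f g"
    proof
      assume "norm (C *v std_gauss_vec K g) > 0"
      then have N: "?N g > 0" by simp
      have "ln (?N g / (?q g / r)) \<le> ?N g / (?q g / r) - 1"
        using q r N by (intro ln_le_minus_one) (simp del: zero_less_power_eq)
      then show "ln (?N g) \<le> f g"
        using q r N by (simp add: f_def ln_div ln_mult mult.commute del: zero_less_power_eq)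
    qed
  qed
  ultimately show ?thesis using that by blast
qed

section \<open>The rounding bound\<close>

lemma gauss_K_factor:
  fixes C :: "complex^'n::finite^'n"
  assumes C: "mat_K K C" and X: "X = C ** ctrans C"
  shows "gauss_K K X = distr gauss_noise borel (\<lambda>g. C *v std_gauss_vec K g)"
proof -
  define U :: "complex^'n^'n" where "U = (SOME U. mat_K K U \<and> X = U ** ctrans U)"
  have "mat_K K U \<and> X = U ** ctrans U"
    unfolding U_def by (rule someI[of _ C]) (use assms in simp)
  then obtain V where V: "unitary_K K V" "U = C ** V"
    using factor_unique_up_to_unitary[of K U C] assms by metis
  have "gauss_K K X = distr (distr gauss_noise borel (\<lambda>g. V *v std_gauss_vec K g)) borel (\<lambda>x. C *v x)"
    unfolding gauss_K_def U_def[symmetric]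
    by (subst distr_distr) (auto simp: comp_def V(2) matrix_vector_mul_assoc)
  also have "\<dots> = distr (distr gauss_noise borel (std_gauss_vec K)) borel (\<lambda>x. C *v x)"
    by (simp only: std_gauss_vec_unitary_invariant[OF V(1)])
  also have "\<dots> = distr gauss_noise borel (\<lambda>g. C *v std_gauss_vec K g)"
    by (subst distr_distr) (auto simp: comp_def)
  finally show ?thesis .
qed

lemma vinner_factor_self:
  "vinner x ((B ** ctrans B) *v x) = of_real ((norm (ctrans B *v x))\<^sup>2)"
proof -
  have "vinner x ((B ** ctrans B) *v x) = vinner (ctrans B *v x) (ctrans B *v x)"
    by (simp add: matrix_vector_mul_assoc[symmetric] vinner_mult_right)
  then show ?thesis by (simp only: vinner_self)
qed

lemma Re_vinner_normalized:
  fixes x :: "complex^'n"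
  shows "Re (vinner ((1 / norm x) *\<^sub>R x) (A *v ((1 / norm x) *\<^sub>R x))) = Re (vinner x (A *v x)) / (norm x)\<^sup>2"
proof -
  have "(1 / norm x) *\<^sub>R x = of_real (1 / norm x) *s x"
    by (simp add: vec_eq_iff scaleR_conv_of_real[where 'a = complex] del: of_real_divide)
  then show ?thesis
    by (simp only: vector_scalar_commute vinner_scale_left vinner_scale_right)
       (simp add: power2_eq_square Re_divide_of_real)
qed

text \<open>A crude bound that makes the rounded objective bounded, hence integrable; otherwise its
  Bochner integral could be the default 0.\<close>

lemma Re_vinner_le_sum_entries:
  fixes A :: "complex^'n^'n"
  assumes "norm y \<le> 1"
  shows "Re (vinner y (A *v y)) \<le> (\<Sum>i\<in>UNIV. \<Sum>j\<in>UNIV. cmod (A $ i $ j))"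
proof -
  have y: "cmod (y $ i) \<le> 1" for i by (rule order_trans[OF Finite_Cartesian_Product.norm_nth_le assms])
  have "Re (vinner y (A *v y)) \<le> cmod (vinner y (A *v y))" by (rule complex_Re_le_cmod)
  also have "\<dots> \<le> (\<Sum>i\<in>UNIV. cmod (y $ i) * cmod ((A *v y) $ i))"
    unfolding vinner_def by (rule order_trans[OF norm_sum]) (simp add: norm_mult)
  also have "\<dots> \<le> (\<Sum>i\<in>UNIV. 1 * (\<Sum>j\<in>UNIV. cmod (A $ i $ j)))"
  proof (intro sum_mono mult_mono y)
    fix i
    have "cmod ((A *v y) $ i) \<le> (\<Sum>j\<in>UNIV. cmod (A $ i $ j) * cmod (y $ j))"
      unfolding matrix_vector_mult_def by (simp add: norm_mult[symmetric] norm_sum)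
    also have "\<dots> \<le> (\<Sum>j\<in>UNIV. cmod (A $ i $ j) * 1)"
      by (intro sum_mono mult_left_mono y) auto
    finally show "cmod ((A *v y) $ i) \<le> (\<Sum>j\<in>UNIV. cmod (A $ i $ j))" by simp
  qed auto
  finally show ?thesis by simp
qed

lemma OptSDP_eq_of_optimal:
  assumes "sdp_optimal K d A X" shows "OptSDP K d A = sdp_obj d A X"
  using assms unfolding OptSDP_def sdp_optimal_def by (intro cSup_eq_maximum) auto

theorem mainTheorem10:
  fixes K :: field_K and d r :: nat
    and A :: "nat \<Rightarrow> complex^'n::finite^'n" and Xs :: "complex^'n^'n"
  assumes "d \<ge> 1"
    and "\<And>i. i < d \<Longrightarrow> psd_K K (A i)"
    and "sdp_optimal K d A Xs"
    and "rank Xs = r"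
  shows "(\<integral>x. (let y = (1 / norm x) *\<^sub>R x in
              (\<Prod>i<d. Re (vinner y (A i *v y)) powr (1 / real d))) \<partial>gauss_K K Xs)
         \<ge> exp (- L_const K r) * OptSDP K d A"
proof -
  interpret prob_space "gauss_noise :: ('n \<times> bool \<Rightarrow> real) measure" by (rule prob_space_gauss_noise)
  let ?W = "std_gauss_vec K :: ('n \<times> bool \<Rightarrow> real) \<Rightarrow> complex^'n"
  have X: "psd_K K Xs" "trace Xs = 1"
    using assms(3) by (auto simp: sdp_optimal_def sdp_feasible_def)
  obtain C :: "complex^'n^'n" and S where C: "mat_K K C" and XC: "Xs = C ** ctrans C"
    and S: "card S = r" and supp: "\<And>i k. k \<notin> S \<Longrightarrow> C $ i $ k = 0"
    using psd_K_factor[OF X(1)] assms(4) by metis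
  have S0: "S \<noteq> {}"
  proof
    assume "S = {}"
    then have "C = 0" using supp by (simp add: vec_eq_iff)
    then have "Xs = 0" using XC by (simp add: matrix_matrix_mult_def vec_eq_iff)
    then show False using X(2) by (simp add: trace_def)
  qed
  then have r: "r > 0" using S by (auto simp: card_gt_0_iff)
  have "\<exists>B :: complex^'n^'n. mat_K K B \<and> A i = B ** ctrans B" if "i < d" for i
    by (rule psd_K_factor[OF assms(2)[OF that]]) blast
  then obtain B :: "nat \<Rightarrow> complex^'n^'n" where B: "\<And>i. i < d \<Longrightarrow> mat_K K (B i)" and AB: "\<And>i. i < d \<Longrightarrow> A i = B i ** ctrans (B i)"
    by metis
  \<comment> \<open>For \<open>x = C *v w\<close> the form \<open>\<langle>x, A i x\<rangle>\<close>
    becomes \<open>\<parallel>M i w\<parallel>^2\<close>, and the trace of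
    \<open>M i ** ctrans (M i)\<close> has real part \<open>t i\<close>.\<close>
  define M where "M i = ctrans (B i) ** C" for i
  define t where "t i = Re (minner (A i) Xs)" for i
  have M: "mat_K K (M i)" if "i < d" for i
    using that by (simp add: M_def mat_K_mult mat_K_ctrans B C)
  have t: "t i = Re (trace (M i ** ctrans (M i)))" if "i < d" for i
  proof -
    have "trace (M i ** ctrans (M i)) = trace (ctrans (B i) ** (Xs ** B i))"
      by (simp add: M_def ctrans_mult XC matrix_mul_assoc)
    also have "\<dots> = trace (A i ** Xs)"
      by (subst trace_mul_sym) (simp add: AB[OF that] matrix_mul_assoc[symmetric], subst trace_mul_sym, simp add: matrix_mul_assoc)
    finally show ?thesis
      by (simp add: t_def minner_def AB[OF that] ctrans_mult)
  qed
  have t_nonneg: "t i \<ge> 0" if "i < d" for i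
    unfolding t[OF that] sum_norm_crow[symmetric] by (simp add: sum_nonneg)
  define F :: "complex^'n \<Rightarrow> real" where "F x = (let y = (1 / norm x) *\<^sub>R x in
              (\<Prod>i<d. Re (vinner y (A i *v y)) powr (1 / real d)))" for x
  have F_eq: "F x = (\<Prod>i<d. (Re (vinner x (A i *v x)) / (norm x)\<^sup>2) powr (1 / real d))" for x
    by (simp add: F_def Let_def Re_vinner_normalized)
  have [measurable]: "(\<lambda>x. Re (vinner x (A i *v x))) \<in> borel_measurable borel" for i
    unfolding vinner_def matrix_vector_mult_def
    by (intro borel_measurable_continuous_onI) (auto intro!: continuous_intros)
  have F_meas [measurable]: "F \<in> borel_measurable borel"
    unfolding F_eq[abs_def] by measurable
  have F_nonneg: "F x \<ge> 0" for x by (simp add: F_eq prod_nonneg)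
  define c where "c = (\<Prod>i<d. (\<Sum>j\<in>UNIV. \<Sum>k\<in>UNIV. cmod (A i $ j $ k)) powr (1 / real d))"
  have F_le: "F x \<le> c" for x
    unfolding F_def Let_def c_def
  proof (intro prod_mono conjI powr_mono2 Re_vinner_le_sum_entries)
    fix i assume "i \<in> {..<d}"
    then show "0 \<le> Re (vinner ((1 / norm x) *\<^sub>R x) (A i *v ((1 / norm x) *\<^sub>R x)))"
      by (simp add: AB vinner_factor_self)
  qed (auto simp: divide_le_eq_1)
  have int_F: "integrable gauss_noise (\<lambda>g. F (C *v ?W g))"
    using F_nonneg F_le by (intro integrable_const_bound[where B = c]) auto
  have lhs: "(\<integral>x. F x \<partial>gauss_K K Xs) = (\<integral>g. F (C *v ?W g) \<partial>gauss_noise)"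
    by (subst gauss_K_factor[OF C XC], subst integral_distr) auto
  have opt: "OptSDP K d A = (\<Prod>i<d. t i) powr (1 / real d)"
    by (simp add: OptSDP_eq_of_optimal[OF assms(3)] sdp_obj_def t_def)
  have "exp (- L_const K r) * OptSDP K d A \<le> (\<integral>g. F (C *v ?W g) \<partial>gauss_noise)"
  proof (cases "\<exists>i<d. t i = 0")
    \<comment> \<open>Logarithms say nothing here, but the optimum is 0 because
      \<open>0 powr p = 0\<close>, and the integrand is nonnegative.\<close>
    case True
    then have "(\<Prod>i<d. t i) = 0" by auto
    then have "OptSDP K d A = 0" by (simp only: opt powr_def simp_thms if_True)
    then show ?thesis by (simp add: F_nonneg)
  next
    case False
    then have t_pos: "t i > 0" if "i < d" for i using t_nonneg[OF that] that by force
    have "\<forall>i. \<exists>f. i < d \<longrightarrow> has_bochner_integral gauss_noise f (ln (t i) + mean_ln_gauss K 1) \<and>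
      (AE g in gauss_noise. norm (M i *v ?W g) > 0 \<and> f g \<le> ln ((norm (M i *v ?W g))\<^sup>2))"
    proof
      fix i
      show "\<exists>f. i < d \<longrightarrow> has_bochner_integral gauss_noise f (ln (t i) + mean_ln_gauss K 1) \<and>
        (AE g in gauss_noise. norm (M i *v ?W g) > 0 \<and> f g \<le> ln ((norm (M i *v ?W g))\<^sup>2))"
      proof (cases "i < d")
        case True
        from ln_norm_sq_minorant[OF M[OF True] t[OF True] t_pos[OF True]] show ?thesis by blast
      qed simp
    qed
    from choice[OF this] obtain f
      where f_int: "\<And>i. i < d \<Longrightarrow> has_bochner_integral gauss_noise (f i) (ln (t i) + mean_ln_gauss K 1)"
      and f_le: "\<And>i. i < d \<Longrightarrow> AE g in gauss_noise. norm (M i *v ?W g) > 0 \<and> f i g \<le> ln ((norm (M i *v ?W g))\<^sup>2)"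
      by blast
    have trC: "Re (trace (C ** ctrans C)) = 1" using X(2) XC by simp
    obtain u where u_int: "has_bochner_integral gauss_noise u (mean_ln_gauss K (card S) - ln (real (card S)))"
      and u_ge: "AE g in gauss_noise. norm (C *v ?W g) > 0 \<longrightarrow> ln ((norm (C *v ?W g))\<^sup>2) \<le> u g"
      by (rule ln_norm_sq_majorant[OF C trC supp S0])
    \<comment> \<open>\<open>l\<close> will bound the logarithm of the rounded objective from below
      almost everywhere, and \<open>m\<close> is its mean: averaging over \<open>i\<close> leaves
      one copy of \<open>mean_ln_gauss K 1\<close>.\<close>
    define l where "l g = (1 / real d) * (\<Sum>i<d. f i g) - u g" for g
    define m where "m = (1 / real d) * (\<Sum>i<d. ln (t i)) - L_const K r"
    have "has_bochner_integral gauss_noise l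
      ((1 / real d) * (\<Sum>i<d. ln (t i) + mean_ln_gauss K 1) - (mean_ln_gauss K (card S) - ln (real (card S))))"
      unfolding l_def
      by (intro has_bochner_integral_diff has_bochner_integral_mult_right has_bochner_integral_sum f_int u_int) auto
    also have "(1 / real d) * (\<Sum>i<d. ln (t i) + mean_ln_gauss K 1) - (mean_ln_gauss K (card S) - ln (real (card S))) = m"
      using assms(1) by (simp add: m_def L_const_eq[OF r] S sum.distrib field_simps)
    finally have l_int: "has_bochner_integral gauss_noise l m" .
    \<comment> \<open>The tangent of \<open>exp\<close> at \<open>m\<close>. Its linear term
      integrates to 0, so this yields Jensen's inequality without integrating
      \<open>exp (l g)\<close>.\<close>
    have F_ge: "AE g in gauss_noise. F (C *v ?W g) \<ge> exp m * (1 + (l g - m))"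
    proof -
      have "AE g in gauss_noise. \<forall>i\<in>{..<d}. norm (M i *v ?W g) > 0 \<and> f i g \<le> ln ((norm (M i *v ?W g))\<^sup>2)"
        by (rule AE_finite_allI) (use f_le in blast)+
      then show ?thesis using u_ge
      proof eventually_elim
        fix g assume g: "\<forall>i\<in>{..<d}. norm (M i *v ?W g) > 0 \<and> f i g \<le> ln ((norm (M i *v ?W g))\<^sup>2)"
          and ug: "norm (C *v ?W g) > 0 \<longrightarrow> ln ((norm (C *v ?W g))\<^sup>2) \<le> u g"
        define x where "x = C *v ?W g"
        have Mx: "M i *v ?W g = ctrans (B i) *v x" for i
          by (simp add: M_def x_def matrix_vector_mul_assoc)
        \<comment> \<open>Index 0 exists because \<open>d\<close> is positive, and a nonzero
          \<open>M 0 w\<close> forces \<open>x\<close> to be nonzero. So the normalisation is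
          genuine and the bound by \<open>u\<close> applies.\<close>
        have "norm (M 0 *v ?W g) > 0" using g assms(1) by auto
        then have "x \<noteq> 0" by (auto simp: Mx)
        then have N: "(norm x)\<^sup>2 > 0" and "norm x > 0" by auto
        with ug have ug': "ln ((norm x)\<^sup>2) \<le> u g" by (simp only: x_def)
        define N' where "N' i = (norm (M i *v ?W g))\<^sup>2" for i
        have N': "N' i > 0" "f i g \<le> ln (N' i)" if "i < d" for i
          using g that by (auto simp: N'_def)
        have "F x = (\<Prod>i<d. (N' i / (norm x)\<^sup>2) powr (1 / real d))"
          unfolding F_eq by (intro prod.cong) (auto simp: AB vinner_factor_self N'_def Mx)
        also have "\<dots> = (\<Prod>i<d. exp ((1 / real d) * (ln (N' i) - ln ((norm x)\<^sup>2))))"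
        proof (intro prod.cong refl)
          fix i assume "i \<in> {..<d}"
          then have "N' i > 0" by (intro N') simp
          then show "(N' i / (norm x)\<^sup>2) powr (1 / real d) = exp ((1 / real d) * (ln (N' i) - ln ((norm x)\<^sup>2)))"
            using N by (simp add: powr_def ln_div)
        qed
        also have "\<dots> = exp (\<Sum>i<d. (1 / real d) * (ln (N' i) - ln ((norm x)\<^sup>2)))"
          by (simp add: exp_sum)
        also have "(\<Sum>i<d. (1 / real d) * (ln (N' i) - ln ((norm x)\<^sup>2))) = (1 / real d) * (\<Sum>i<d. ln (N' i)) - ln ((norm x)\<^sup>2)"
          using assms(1) by (simp add: sum_distrib_left[symmetric] sum_subtractf sum_divide_distrib[symmetric] diff_divide_distrib)
        finally have "F x = exp ((1 / real d) * (\<Sum>i<d. ln (N' i)) - ln ((norm x)\<^sup>2))" .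
        moreover have "l g \<le> (1 / real d) * (\<Sum>i<d. ln (N' i)) - ln ((norm x)\<^sup>2)"
          unfolding l_def using N'(2) by (intro diff_mono ug' mult_left_mono sum_mono) auto
        ultimately have "exp (l g) \<le> F x" by simp
        moreover have "exp m * (1 + (l g - m)) \<le> exp m * exp (l g - m)"
          by (intro mult_left_mono exp_ge_add_one_self) auto
        ultimately show "F (C *v ?W g) \<ge> exp m * (1 + (l g - m))"
          by (simp add: x_def exp_diff)
      qed
    qed
    have "exp (- L_const K r) * OptSDP K d A = exp m"
    proof -
      have t_nz: "t i \<noteq> 0" if "i < d" for i using t_pos[OF that] by simp
      have "(\<Prod>i<d. t i) > 0" using t_pos by (intro prod_pos) auto
      moreover have "ln (\<Prod>i<d. t i) = (\<Sum>i<d. ln (t i))" using t_nz by (intro ln_prod) auto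
      ultimately have "OptSDP K d A = exp ((1 / real d) * (\<Sum>i<d. ln (t i)))"
        using t_nz by (auto simp: opt powr_def)
      then show ?thesis by (simp add: m_def exp_add[symmetric])
    qed
    also have "\<dots> = (\<integral>g. exp m * (1 + (l g - m)) \<partial>gauss_noise)"
      using l_int by (simp add: has_bochner_integral_iff prob_space)
    also have "\<dots> \<le> (\<integral>g. F (C *v ?W g) \<partial>gauss_noise)"
      using l_int by (intro integral_mono_AE int_F F_ge) (auto simp: has_bochner_integral_iff)
    finally show ?thesis .
  qed
  then have "exp (- L_const K r) * OptSDP K d A \<le> (\<integral>x. F x \<partial>gauss_K K Xs)" by (simp only: lhs)
  then show ?thesis by (simp only: F_def)
qed

end
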